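(* Let $f\in L_\infty[0,1]$ be a real-valued function with $\int_{[0,1]} f\,d\lambda=0$, and let $\epsilon>0$. Then there exist a function $g\in L_\infty[0,1]$ with $\|g\|_\infty\le (1+\epsilon)\|f\|_\infty$ and a measure preserving transformation mod0 $T$ of $[0,1]$ such that $f=g\circ T-g$ (equality in $L_\infty[0,1]$, i.e. almost everywhere).
   Context: $\lambda$ denotes Lebesgue measure, and $[0,1]$ is equipped with its Borel $\sigma$-algebra and $\lambda$. $L_\infty[0,1]$ is the space of essentially bounded real-valued functions on $[0,1]$ modulo equality almost everywhere, and $\|\cdot\|_\infty$ is the essential supremum norm. A measure preserving transformation mod0 between measure spaces $(\Omega,\mathcal{A},\mu)$ and $(\Omega',\mathcal{A}',\mu')$ is a bijection $T:\Omega\setminus N\to\Omega'\setminus N'$, for some null sets $N\in\mathcal{A}$ and $N'\in\mathcal{A}'$, such that both $T$ and $T^{-1}$ are measurable and $\mu'(T(A))=\mu(A)$ for all $A\in\mathcal{A}$ with $A\subseteq\Omega\setminus N$. A measure preserving transformation mod0 of a space is one from the space to itself. *)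

theory Defs
  imports "HOL-Probability.Essential_Supremum"
begin

abbreviation unit_interval :: "real measure" where
  "unit_interval \<equiv> restrict_space lborel {0..1}"

text \<open>
  The norm is an extended real, so that it is meaningful for every measurable function; it is
  nonnegative whenever \<^term>\<open>M\<close> is not the null measure.
\<close>

definition Linf_norm :: "'a measure \<Rightarrow> ('a \<Rightarrow> real) \<Rightarrow> ereal" where
  "Linf_norm M f = esssup M (\<lambda>x. ereal \<bar>f x\<bar>)"

text \<open>
  Elements of $L_\infty$ are represented by functions; equality in $L_\infty$ is equality almost
  everywhere with respect to \<^term>\<open>M\<close>.
\<close>

definition Linf :: "'a measure \<Rightarrow> ('a \<Rightarrow> real) set" where
  "Linf M = {f \<in> borel_measurable M. Linf_norm M f < \<infinity>}"

text \<open>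
  A partially defined map is modelled by a total function \<^term>\<open>T\<close> whose values on the null set
  \<^term>\<open>N\<close> are irrelevant.
\<close>

definition measure_preserving_mod0 :: "'a measure \<Rightarrow> 'b measure \<Rightarrow> ('a \<Rightarrow> 'b) \<Rightarrow> bool" where
  "measure_preserving_mod0 M M' T \<longleftrightarrow>
    (\<exists>N \<in> null_sets M. \<exists>N' \<in> null_sets M'.
      bij_betw T (space M - N) (space M' - N') \<and>
      T \<in> restrict_space M (space M - N) \<rightarrow>\<^sub>M restrict_space M' (space M' - N') \<and>
      the_inv_into (space M - N) T
        \<in> restrict_space M' (space M' - N') \<rightarrow>\<^sub>M restrict_space M (space M - N) \<and>
      (\<forall>A \<in> sets M. A \<subseteq> space M - N \<longrightarrow> emeasure M' (T ` A) = emeasure M A))"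

end

theory Submission
  imports Defs "HOL-Probability.Probability"
begin

text \<open>
  The idea is to build \<open>T\<close> by cutting and stacking. At each stage the space is divided into
  towers: every point of a base set carries a finite orbit segment of the current transformation
  \<open>T\<close>, which sends the top of the segment back to its base point. Let \<open>g\<close> be the sum of \<open>f\<close> over the
  part of the tower below a point, so that \<open>g = 0\<close> on the base, and let \<open>F\<close> be the sum of \<open>f\<close> over
  the whole tower, placed at the base point and extended by \<open>0\<close>. Then
  \<open>f = g \<circ> T - g + F \<circ> T\<close>, and the goal is to reach \<open>F = 0\<close> while \<open>\<bar>g\<bar> \<le> c\<close>, where \<open>c\<close> is the norm
  of \<open>f\<close>. Initially every tower is a single point, \<open>T\<close> is the identity, \<open>F = f\<close> and \<open>g = 0\<close>. Given
  two sets \<open>B\<close> and \<open>C\<close> of base points with equal measure, the towers over \<open>C\<close> can be put on top of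
  those over \<open>B\<close>: compose \<open>T\<close> with an involution that exchanges \<open>B\<close> and \<open>C\<close>. The tower sums then
  add up over \<open>B\<close>, and \<open>g\<close> is shifted on the towers over \<open>C\<close> by the sums of the towers below them.
  Stacking towers with sums of opposite sign makes the sums cancel in part and makes the base
  smaller.

  The point is to keep \<open>\<bar>g\<bar> \<le> c\<close> through infinitely many such steps, without any loss in the
  constant. Let \<open>-b \<le> F \<le> a\<close> with optimal \<open>a\<close> and \<open>b\<close>. The invariant is that
  \<open>-c + b \<le> g \<le> c\<close> on towers with positive sum and \<open>-c \<le> g \<le> c - a\<close> on towers with negative sum:
  there is room to lower a positive tower by the sum of any negative one and to raise a negative
  tower by the sum of any positive one. (For \<open>f\<close> with two values \<open>\<alpha>\<close> and \<open>-\<beta>\<close> this is the picture of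
  the rotation by \<open>\<alpha>\<close> on a circle of length \<open>\<alpha> + \<beta>\<close> and of its induced maps on shorter intervals.) The
  invariant survives if the base tower has the larger sum in absolute value, which must moreover be
  at least as large as the new bound for the sums of opposite sign (\<open>stack_towers\<close>).

  Such a step exists whenever \<open>F\<close> is not zero almost everywhere (\<open>progress\<close>). As \<open>F\<close> has mean zero,
  it takes both signs, and by the symmetry \<open>f \<mapsto> -f\<close> one may assume \<open>a \<le> b\<close>. If \<open>a < b\<close>, put positive
  towers on top of towers with sum below \<open>-a\<close>. If \<open>a = b\<close>, the symmetry also allows one to assume
  that sums above \<open>a / 2\<close> occupy no more of the base than sums below \<open>-a / 2\<close>; then match all towers
  with sum above \<open>a / 2\<close> with the lowest negative towers of the same total base measure. The new
  bounds are \<open>a / 2\<close> and \<open>t\<close>, where \<open>-t\<close> is the threshold below which the negative towers are used.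

  A step changes \<open>T\<close>, its inverse and \<open>F\<close> on sets whose measure is at most twice the measure lost by
  the base. So along a sequence of steps the changes have finite total measure, all three are
  eventually constant almost everywhere by the Borel-Cantelli lemma, and the upper limit of the
  potentials \<open>g\<close> works for the limit (\<open>castle_chain_limit\<close>). The bases therefore cannot shrink
  forever without a limit that can be continued: an exhaustion argument
  (\<open>maximal_of_chain_closed\<close>) gives a stage that no step can improve, and there \<open>F = 0\<close>
  (\<open>bounded_coboundary\<close>).
\<close>

section \<open>Swapping sets of equal Lebesgue measure\<close>

text \<open>
  The distribution function \<open>u\<close> carries \<open>P\<close> to the uniform distribution. Its generalised inverse
  is a right inverse because \<open>u\<close> is continuous when there are no atoms, and then it is a left inverse
  almost everywhere because it carries the uniform distribution back to \<open>P\<close>.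
\<close>
lemma atomless_isomorphic_uniform:
  fixes P :: "real measure"
  assumes "real_distribution P" and atomless: "\<And>x. measure P {x} = 0"
  defines "V \<equiv> restrict_space lborel {0<..<1::real}"
  obtains u v :: "real \<Rightarrow> real"
  where "u \<in> borel_measurable borel" "v \<in> borel_measurable borel"
    and "distr P borel u = distr V borel (\<lambda>x. x)" "distr V borel v = P"
    and "AE x in P. v (u x) = x" "\<And>w. w \<in> {0<..<1} \<Longrightarrow> u (v w) = w"
proof -
  interpret P: cdf_distribution P
    unfolding cdf_distribution_def by fact
  define v where "v w = (if w \<in> {0<..<1} then P.I w else 0)" for w
  have [measurable]: "P.I \<in> borel_measurable V"
    unfolding V_def using P.measurable_CI by (simp add: measurable_def sets_restrict_space space_restrict_space)
  have vV: "v \<in> borel_measurable borel"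
    unfolding v_def using P.measurable_CI
    by (subst measurable_restrict_space_iff[symmetric]) auto
  have spV: "space V = {0<..<1}" by (simp add: V_def space_restrict_space)
  have inv: "P.C (v w) = w" if w: "w \<in> {0<..<1}" for w
  proof (rule antisym)
    show "w \<le> P.C (v w)" using P.pseudoinverse'[rule_format, OF w, of "v w"] w by (simp add: v_def)
    have cont: "isCont P.C (v w)" by (simp add: P.isCont_cdf atomless)
    have lim: "(P.C \<longlongrightarrow> P.C (v w)) (at_left (v w))"
      using cont unfolding continuous_at_split by (simp add: continuous_within)
    have "eventually (\<lambda>x. P.C x \<le> w) (at_left (v w))"
      unfolding eventually_at_filter
    proof (rule always_eventually, intro allI impI)
      fix x assume "x \<noteq> v w" "x \<in> {..<v w}"
      then have "\<not> w \<le> P.C x" using P.pseudoinverse'[rule_format, OF w, of x] w by (simp add: v_def)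
      then show "P.C x \<le> w" by simp
    qed
    then show "P.C (v w) \<le> w" by (rule tendsto_upperbound[OF lim]) simp
  qed
  have [measurable]: "v \<in> borel_measurable V" 
    by (simp add: V_def) (rule measurable_restrict_space1, use vV in simp)
  have distv: "distr V borel v = P"
  proof -
    have "distr V borel v = distr V borel P.I"
      by (rule distr_cong) (auto simp: v_def spV)
    then show ?thesis using P.distr_I_eq_M by (simp add: V_def)
  qed
  have distu: "distr P borel P.C = distr V borel (\<lambda>x. x)"
  proof -
    have "distr P borel P.C = distr (distr V borel v) borel P.C" by (simp add: distv)
    also have "\<dots> = distr V borel (P.C \<circ> v)" by (rule distr_distr) auto
    also have "\<dots> = distr V borel (\<lambda>x. x)" by (rule distr_cong) (auto simp: spV inv)
    finally show ?thesis .
  qed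
  have "AE x in distr V borel v. v (P.C x) = x"
    using vV by (subst AE_distr_iff) (auto simp: spV inv intro!: AE_I2)
  then have "AE x in P. v (P.C x) = x" unfolding distv .
  with distu distv vV inv show ?thesis by (intro that[of "P.C" v]) auto
qed

lemma atomless_distributions_isomorphic:
  fixes P Q :: "real measure"
  assumes P: "real_distribution P" "\<And>x. measure P {x} = 0"
    and Q: "real_distribution Q" "\<And>x. measure Q {x} = 0"
  obtains f g :: "real \<Rightarrow> real"
  where "f \<in> borel_measurable borel" "g \<in> borel_measurable borel"
    and "distr P borel f = Q" "distr Q borel g = P"
    and "AE x in P. g (f x) = x" "AE y in Q. f (g y) = y"
proof -
  interpret P: real_distribution P by fact
  interpret Q: real_distribution Q by fact
  define V where "V = restrict_space lborel {0<..<1::real}"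
  have spV: "space V = {0<..<1}" by (simp add: V_def space_restrict_space)
  have idV [measurable]: "(\<lambda>x. x) \<in> borel_measurable V"
    by (simp add: V_def) (rule measurable_restrict_space1, simp)
  obtain u v where u: "u \<in> borel_measurable borel" and v: "v \<in> borel_measurable borel"
    and du: "distr P borel u = distr V borel (\<lambda>x. x)" and dv: "distr V borel v = P"
    and vu: "AE x in P. v (u x) = x" and uv: "\<And>w. w \<in> {0<..<1} \<Longrightarrow> u (v w) = w"
    using atomless_isomorphic_uniform[OF P] unfolding V_def by blast
  obtain u' v' where u': "u' \<in> borel_measurable borel" and v': "v' \<in> borel_measurable borel"
    and du': "distr Q borel u' = distr V borel (\<lambda>x. x)" and dv': "distr V borel v' = Q"
    and vu': "AE x in Q. v' (u' x) = x" and uv': "\<And>w. w \<in> {0<..<1} \<Longrightarrow> u' (v' w) = w"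
    using atomless_isomorphic_uniform[OF Q] unfolding V_def by blast
  note [measurable] = u v u' v'
  have range_u: "AE x in P. u x \<in> {0<..<1}"
  proof -
    have "AE x in distr P borel u. x \<in> {0<..<1}"
      unfolding du by (subst AE_distr_iff) (auto simp: spV intro!: AE_I2)
    then show ?thesis by (subst (asm) AE_distr_iff) auto
  qed
  have range_u': "AE x in Q. u' x \<in> {0<..<1}"
  proof -
    have "AE x in distr Q borel u'. x \<in> {0<..<1}"
      unfolding du' by (subst AE_distr_iff) (auto simp: spV intro!: AE_I2)
    then show ?thesis by (subst (asm) AE_distr_iff) auto
  qed
  have vV [measurable]: "v \<in> borel_measurable V" "v' \<in> borel_measurable V"
    using v v' by (simp_all add: V_def measurable_restrict_space1)
  have "distr P borel (v' \<circ> u) = distr (distr P borel u) borel v'" 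
    by (rule distr_distr[symmetric]) auto
  also have "\<dots> = distr V borel (v' \<circ> (\<lambda>x. x))" unfolding du by (rule distr_distr) auto
  finally have d1: "distr P borel (v' \<circ> u) = Q" by (simp add: dv' o_def)
  have "distr Q borel (v \<circ> u') = distr (distr Q borel u') borel v" 
    by (rule distr_distr[symmetric]) auto
  also have "\<dots> = distr V borel (v \<circ> (\<lambda>x. x))" unfolding du' by (rule distr_distr) auto
  finally have d2: "distr Q borel (v \<circ> u') = P" by (simp add: dv o_def)
  show ?thesis
  proof (rule that[of "v' \<circ> u" "v \<circ> u'"])
    show "AE x in P. (v \<circ> u') ((v' \<circ> u) x) = x"
      using range_u vu by eventually_elim (simp add: uv')
    show "AE x in Q. (v' \<circ> u) ((v \<circ> u') x) = x"
      using range_u' vu' by eventually_elim (simp add: uv)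
  qed (use d1 d2 in auto)
qed

lemma uniform_measure_real_distribution:
  assumes "B \<in> sets borel" "emeasure lborel B \<noteq> 0" "emeasure lborel B < \<infinity>"
  shows "real_distribution (uniform_measure lborel B)"
    and "measure (uniform_measure lborel B) {x} = 0"
proof -
  interpret prob_space "uniform_measure lborel B"
    using assms by (intro prob_space_uniform_measure) auto
  show "real_distribution (uniform_measure lborel B)"
    by standard (auto simp: assms)
  have "emeasure lborel (B \<inter> {x}) \<le> emeasure lborel {x}"
    using assms(1) by (intro emeasure_mono) auto
  then have "emeasure lborel (B \<inter> {x}) = 0" by simp
  then show "measure (uniform_measure lborel B) {x} = 0"
    using assms by (simp add: measure_def)
qed

text \<open>
  These involutions are the only source of new transformations: the normalised Lebesgue measures on
  \<open>B\<close> and \<open>C\<close> are atomless, so an isomorphism between them and its inverse can be glued together.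
\<close>
lemma measurable_swap_of_equal_measure:
  fixes B C :: "real set"
  assumes BC: "B \<in> sets borel" "C \<in> sets borel" "B \<subseteq> {0..1}" "C \<subseteq> {0..1}" "B \<inter> C = {}"
    and eq: "emeasure lborel B = emeasure lborel C"
  obtains s where "s \<in> borel_measurable borel" "s \<in> unit_interval \<rightarrow>\<^sub>M unit_interval"
    "distr unit_interval unit_interval s = unit_interval"
    "AE x in unit_interval. s (s x) = x"
    "AE x in unit_interval. (x \<in> B \<longrightarrow> s x \<in> C) \<and> (x \<in> C \<longrightarrow> s x \<in> B)"
    "\<And>x. x \<notin> B \<union> C \<Longrightarrow> s x = x"
proof (cases "emeasure lborel B = 0")
  case True
  have "AE x in lborel. x \<notin> B" "AE x in lborel. x \<notin> C"
    using True eq BC by (auto intro!: AE_not_in null_setsI)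
  then have "AE x in unit_interval. (x \<in> B \<longrightarrow> id x \<in> C) \<and> (x \<in> C \<longrightarrow> id x \<in> B)"
    by (subst AE_restrict_space_iff) auto
  moreover have "distr unit_interval unit_interval id = unit_interval" 
    by (simp add: id_def distr_id)
  ultimately show ?thesis by (intro that[of id]) auto
next
  case False
  define m where "m = emeasure lborel B"
  define P where "P = uniform_measure lborel B"
  define Q where "Q = uniform_measure lborel C"
  have "emeasure lborel B \<le> emeasure lborel {0..1::real}"
    using BC by (intro emeasure_mono) auto
  then have fin: "emeasure lborel B < \<infinity>" by (simp add: le_less_trans)
  have m: "m \<noteq> 0" "m < \<infinity>" using False fin by (auto simp: m_def)
  obtain f g where f: "f \<in> borel_measurable borel" and g: "g \<in> borel_measurable borel"
    and df: "distr P borel f = Q" and dg: "distr Q borel g = P"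
    and gf: "AE x in P. g (f x) = x" and fg: "AE y in Q. f (g y) = y"
    by (rule atomless_distributions_isomorphic[of P Q])
       (use False fin BC eq uniform_measure_real_distribution in \<open>auto simp: P_def Q_def\<close>)
  note [measurable] = f g BC(1,2)
  have AEP: "(AE x in P. R x) \<longleftrightarrow> (AE x in lborel. x \<in> B \<longrightarrow> R x)" for R
    unfolding P_def using BC False fin by (intro AE_uniform_measure) auto
  have AEQ: "(AE x in Q. R x) \<longleftrightarrow> (AE x in lborel. x \<in> C \<longrightarrow> R x)" for R
    unfolding Q_def using BC False fin eq by (intro AE_uniform_measure) auto
  have mP: "f \<in> borel_measurable P" "g \<in> borel_measurable Q" 
    by (auto simp: P_def Q_def)
  have fB: "AE x in lborel. x \<in> B \<longrightarrow> f x \<in> C"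
  proof -
    have "AE x in distr P borel f. x \<in> C" unfolding df AEQ by simp
    then show ?thesis by (subst (asm) AE_distr_iff) (auto simp: AEP mP)
  qed
  have gC: "AE x in lborel. x \<in> C \<longrightarrow> g x \<in> B"
  proof -
    have "AE x in distr Q borel g. x \<in> B" unfolding dg AEP by simp
    then show ?thesis by (subst (asm) AE_distr_iff) (auto simp: AEQ mP)
  qed
  define s where "s x = (if x \<in> B \<and> f x \<in> C then f x else if x \<in> C \<and> g x \<in> B then g x else x)" for x
  have s_borel [measurable]: "s \<in> borel_measurable borel" unfolding s_def by measurable
  have s01: "s x \<in> {0..1}" if "x \<in> {0..1}" for x using that BC unfolding s_def by (auto split: if_splits)
  have meas: "s \<in> unit_interval \<rightarrow>\<^sub>M unit_interval"
    by (intro measurable_restrict_space2 measurable_restrict_space1)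
       (use s01 in \<open>auto simp: space_restrict_space\<close>)
  have ss: "AE x in lborel. s (s x) = x"
    using fB gC gf[unfolded AEP] fg[unfolded AEQ] 
    by eventually_elim (use BC in \<open>auto simp: s_def\<close>)
  have sBC: "AE x in lborel. (x \<in> B \<longrightarrow> s x \<in> C) \<and> (x \<in> C \<longrightarrow> s x \<in> B)"
    using fB gC by eventually_elim (use BC in \<open>auto simp: s_def\<close>)
  have restr: "AE x in unit_interval. R x" if "AE x in lborel. R x" for R
    using that by (subst AE_restrict_space_iff) (auto elim: eventually_mono)
  \<comment> \<open>On each of the two sets the involution transports measure, because the isomorphism transports the normalised measures.\<close>
  have emP: "emeasure lborel (B \<inter> f -` E) = emeasure lborel (C \<inter> E)" if [measurable]: "E \<in> sets borel" for E
  proof -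
    have "emeasure Q E = emeasure (distr P borel f) E" by (simp add: df)
    also have "\<dots> = emeasure P (f -` E)" by (subst emeasure_distr) (auto simp: mP, simp add: P_def)
    finally have "emeasure lborel (C \<inter> E) / m = emeasure lborel (B \<inter> f -` E) / m"
      using measurable_sets_borel[OF f that] by (simp add: P_def Q_def m_def eq)
    then have "emeasure lborel (C \<inter> E) / m * m = emeasure lborel (B \<inter> f -` E) / m * m" by simp
    then show ?thesis using m by (simp add: ennreal_divide_times ennreal_mult_divide_eq top.not_eq_extremum)
  qed
  have emQ: "emeasure lborel (C \<inter> g -` E) = emeasure lborel (B \<inter> E)" if [measurable]: "E \<in> sets borel" for E
  proof -
    have "emeasure P E = emeasure (distr Q borel g) E" by (simp add: dg)
    also have "\<dots> = emeasure Q (g -` E)" by (subst emeasure_distr) (auto simp: mP, simp add: Q_def)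
    finally have "emeasure lborel (B \<inter> E) / m = emeasure lborel (C \<inter> g -` E) / m"
      using measurable_sets_borel[OF g that] by (simp add: P_def Q_def m_def eq)
    then have "emeasure lborel (B \<inter> E) / m * m = emeasure lborel (C \<inter> g -` E) / m * m" by simp
    then show ?thesis using m by (simp add: ennreal_divide_times ennreal_mult_divide_eq top.not_eq_extremum)
  qed
  have "distr unit_interval unit_interval s = unit_interval"
  proof (rule measure_eqI)
    fix E assume "E \<in> sets (distr unit_interval unit_interval s)"
    then have E: "E \<in> sets borel" "E \<subseteq> {0..1}" by (auto simp: sets_restrict_space)
    note [measurable] = E(1)
    have pre: "f -` E \<in> sets borel" "g -` E \<in> sets borel" "s -` E \<in> sets borel"
      using E(1) measurable_sets_borel[OF f] measurable_sets_borel[OF g] measurable_sets_borel[OF s_borel] by auto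
    have "emeasure (distr unit_interval unit_interval s) E = emeasure unit_interval (s -` E \<inter> {0..1})"
      using meas E by (subst emeasure_distr) (auto simp: sets_restrict_space space_restrict_space)
    also have "\<dots> = emeasure lborel (s -` E \<inter> {0..1})"
      by (subst emeasure_restrict_space) auto
    also have "\<dots> = emeasure lborel ((B \<inter> f -` E) \<union> (C \<inter> g -` E) \<union> (E - B - C))"
    proof (rule emeasure_eq_AE)
      show "AE x in lborel. x \<in> s -` E \<inter> {0..1} \<longleftrightarrow> x \<in> (B \<inter> f -` E) \<union> (C \<inter> g -` E) \<union> (E - B - C)"
        using fB gC by eventually_elim (use BC E in \<open>auto simp: s_def\<close>)
    qed (use pre in auto)
    also have "\<dots> = emeasure lborel (B \<inter> f -` E) + emeasure lborel (C \<inter> g -` E) + emeasure lborel (E - B - C)"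
      using BC(5) pre by (subst plus_emeasure[symmetric], simp, simp, blast)+ simp
    also have "\<dots> = emeasure lborel (C \<inter> E) + emeasure lborel (B \<inter> E) + emeasure lborel (E - B - C)"
      by (simp add: emP emQ)
    also have "\<dots> = emeasure lborel ((C \<inter> E) \<union> (B \<inter> E) \<union> (E - B - C))"
      using BC(5) by (subst plus_emeasure, simp, simp, blast)+ simp
    also have "(C \<inter> E) \<union> (B \<inter> E) \<union> (E - B - C) = E" by auto
    also have "emeasure lborel E = emeasure unit_interval E"
      using E by (subst emeasure_restrict_space) auto
    finally show "emeasure (distr unit_interval unit_interval s) E = emeasure unit_interval E" .
  qed simp
  then show ?thesis
    using meas restr[OF ss] restr[OF sBC] by (intro that[of s]) (auto simp: s_def)
qed

text \<open>
  The measure of \<open>E \<union> (G \<inter> {..t})\<close> depends on \<open>t\<close> in a Lipschitz way, so the intermediate value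
  theorem applies.
\<close>
lemma intermediate_measure:
  fixes E G :: "real set"
  assumes EG: "E \<in> sets borel" "G \<in> sets borel" "E \<subseteq> G" "G \<subseteq> {0..1}"
    and m: "measure lborel E \<le> m" "m \<le> measure lborel G"
  obtains H where "H \<in> sets borel" "E \<subseteq> H" "H \<subseteq> G" "measure lborel H = m"
proof -
  note [measurable] = EG(1,2)
  have fin: "emeasure lborel X < \<infinity>" if "X \<subseteq> {0..1}" for X :: "real set"
  proof -
    have "emeasure lborel X \<le> emeasure lborel {0..1::real}" using that by (intro emeasure_mono) auto
    then show ?thesis by (simp add: le_less_trans)
  qed
  define H where "H t = E \<union> (G \<inter> {..t})" for t
  define h where "h t = measure lborel (H t)" for t
  have [measurable]: "H t \<in> sets borel" for t unfolding H_def by auto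
  have H01: "H t \<subseteq> {0..1}" for t using EG by (auto simp: H_def)
  have fH: "H t \<in> fmeasurable lborel" for t using fin[OF H01] by (intro fmeasurableI) auto
  have lip: "h t - h u \<le> t - u" if "u \<le> t" for t u
  proof -
    have sub: "H t \<subseteq> H u \<union> {u..t}" by (auto simp: H_def)
    have "{u..t} \<in> fmeasurable lborel"
      by (rule fmeasurableI) (auto simp: emeasure_lborel_Icc_eq)
    then have "measure lborel (H t) \<le> measure lborel (H u \<union> {u..t})"
      using sub fH by (intro measure_mono_fmeasurable fmeasurable.Un) auto
    also have "\<dots> \<le> measure lborel (H u) + measure lborel {u..t}"
      using fH by (intro measure_Un_le) auto
    finally show ?thesis using that by (simp add: h_def)
  qed
  have mono: "h u \<le> h t" if "u \<le> t" for u t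
    unfolding h_def using that fH by (intro measure_mono_fmeasurable) (auto simp: H_def)
  have "1-lipschitz_on UNIV h"
  proof (rule lipschitz_onI)
    fix x y :: real
    show "dist (h x) (h y) \<le> 1 * dist x y"
      using lip[of x y] lip[of y x] mono[of x y] mono[of y x] by (cases "x \<le> y") (auto simp: dist_real_def)
  qed auto
  then have cont: "continuous_on {-1..1} h" by (metis lipschitz_on_continuous_on continuous_on_subset subset_UNIV)
  have "H (-1) = E" "H 1 = G" using EG by (auto simp: H_def)
  then have "h (-1) \<le> m" "m \<le> h 1" using m by (auto simp: h_def)
  from IVT'[OF this _ cont] obtain t where "h t = m" by auto
  then show ?thesis using EG by (intro that[of "H t"]) (auto simp: h_def H_def)
qed

section \<open>Upper limits, eventually constant sequences and exhaustion\<close>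

text \<open>
  The upper limit is used in place of a limit: it needs no convergence and still commutes with
  adding constants and respects bounds, which is all that the conditions on the potentials require.
\<close>
definition real_limsup :: "(nat \<Rightarrow> real) \<Rightarrow> real" where
  "real_limsup u = real_of_ereal (limsup (\<lambda>n. ereal (u n)))"

lemma ereal_real_limsup:
  assumes "\<And>n. \<bar>u n\<bar> \<le> c"
  shows "ereal (real_limsup u) = limsup (\<lambda>n. ereal (u n))"
proof -
  have "limsup (\<lambda>n. ereal (u n)) \<le> ereal c"
    using assms by (intro Limsup_bounded always_eventually) (auto simp: abs_le_iff)
  moreover have "ereal (- c) \<le> liminf (\<lambda>n. ereal (u n))"
  proof (intro Liminf_bounded always_eventually allI)
    fix n show "ereal (- c) \<le> ereal (u n)" using assms[of n] by auto
  qed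
  moreover have "liminf (\<lambda>n. ereal (u n)) \<le> limsup (\<lambda>n. ereal (u n))"
    by (rule Liminf_le_Limsup) simp
  ultimately show ?thesis
    unfolding real_limsup_def by (cases "limsup (\<lambda>n. ereal (u n))") auto
qed

lemma real_limsup_le:
  assumes "\<And>n. \<bar>u n\<bar> \<le> c" "eventually (\<lambda>n. u n \<le> d) sequentially"
  shows "real_limsup u \<le> d"
proof -
  have "limsup (\<lambda>n. ereal (u n)) \<le> ereal d"
    using assms(2) by (intro Limsup_bounded) (auto elim: eventually_mono)
  then show ?thesis by (simp flip: ereal_real_limsup[of u c, OF assms(1)])
qed

lemma real_limsup_ge:
  assumes "\<And>n. \<bar>u n\<bar> \<le> c" "eventually (\<lambda>n. d \<le> u n) sequentially"
  shows "d \<le> real_limsup u"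
proof -
  have "ereal d \<le> liminf (\<lambda>n. ereal (u n))"
    using assms(2) by (intro Liminf_bounded) (auto elim: eventually_mono)
  also have "\<dots> \<le> limsup (\<lambda>n. ereal (u n))"
    by (rule Liminf_le_Limsup) simp
  finally show ?thesis by (simp flip: ereal_real_limsup[of u c, OF assms(1)])
qed

lemma real_limsup_add:
  assumes "\<And>n. \<bar>u n\<bar> \<le> c" "\<And>n. \<bar>v n\<bar> \<le> c" "eventually (\<lambda>n. v n = u n + d) sequentially"
  shows "real_limsup v = real_limsup u + d"
proof -
  have "limsup (\<lambda>n. ereal (v n)) = limsup (\<lambda>n. ereal (u n) + ereal d)"
    using assms(3) by (intro Limsup_eq) (auto elim: eventually_mono)
  also have "\<dots> = limsup (\<lambda>n. ereal (u n)) + ereal d"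
    by (rule Limsup_add_ereal_right) auto
  finally have "ereal (real_limsup v) = ereal (real_limsup u) + ereal d"
    by (simp only: ereal_real_limsup[of u c, OF assms(1)] ereal_real_limsup[of v c, OF assms(2)])
  then show ?thesis by simp
qed

lemma borel_measurable_real_limsup [measurable (raw)]:
  assumes "\<And>n. (\<lambda>x. u x n) \<in> borel_measurable M"
  shows "(\<lambda>x. real_limsup (u x)) \<in> borel_measurable M"
  using assms unfolding real_limsup_def by measurable

lemma eventually_constant_lim:
  fixes u :: "nat \<Rightarrow> 'b::t2_space"
  assumes "eventually (\<lambda>n. u n = u (Suc n)) sequentially"
  shows "eventually (\<lambda>n. u n = lim u) sequentially"
proof -
  obtain N where N: "\<And>n. n \<ge> N \<Longrightarrow> u n = u (Suc n)"
    using assms by (auto simp: eventually_sequentially)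
  have "u (N + k) = u N" for k by (induction k) (simp_all add: N[symmetric])
  then have "u n = u N" if "n \<ge> N" for n by (metis that le_iff_add)
  then have ev: "eventually (\<lambda>n. u n = u N) sequentially"
    unfolding eventually_sequentially by blast
  then have "lim u = u N" by (intro limI tendsto_eventually)
  then show ?thesis using ev by simp
qed

text \<open>
  The difference \<open>m n - l\<close> is a budget for all changes from stage \<open>n\<close> on. As it is finite, the
  Borel-Cantelli lemma shows that almost every point is changed finitely often.
\<close>
lemma (in prob_space) eventually_constant_AE:
  fixes h :: "nat \<Rightarrow> 'a \<Rightarrow> real" and m :: "nat \<Rightarrow> real"
  assumes h [measurable]: "\<And>n. h n \<in> borel_measurable M"
    and step: "\<And>n. measure M {x \<in> space M. h n x \<noteq> h (Suc n) x} \<le> m n - m (Suc n)"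
    and lim: "m \<longlonglongrightarrow> l"
  shows "AE x in M. eventually (\<lambda>n. h n x = lim (\<lambda>n. h n x)) sequentially"
    and "measure M {x \<in> space M. h n x \<noteq> lim (\<lambda>n. h n x)} \<le> m n - l"
proof -
  define A where "A n = {x \<in> space M. h n x \<noteq> h (Suc n) x}" for n
  have [measurable]: "A n \<in> sets M" for n unfolding A_def by measurable
  have tele: "(\<lambda>k. m (n + k) - m (Suc (n + k))) sums (m n - l)" for n
    using telescope_sums'[of "\<lambda>k. m (n + k)" l] LIMSEQ_ignore_initial_segment[OF lim, of n]
    by (simp add: add.commute)
  have summ: "summable (\<lambda>k. measure M (A (n + k)))" for n
    by (rule summable_comparison_test'[OF sums_summable[OF tele[of n]], of 0])
       (use step in \<open>simp add: A_def\<close>)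
  have "AE x in M. eventually (\<lambda>n. x \<in> space M - A n) sequentially"
    using summ[of 0] by (intro borel_cantelli_AE1) (auto simp: emeasure_eq_measure)
  then show ev: "AE x in M. eventually (\<lambda>n. h n x = lim (\<lambda>n. h n x)) sequentially"
  proof eventually_elim
    case (elim x)
    then have "eventually (\<lambda>n. h n x = h (Suc n) x) sequentially"
      by (auto elim!: eventually_mono simp: A_def)
    then show ?case by (rule eventually_constant_lim)
  qed
  have "measure M {x \<in> space M. h n x \<noteq> lim (\<lambda>n. h n x)} \<le> measure M (\<Union>k. A (n + k))"
  proof (rule finite_measure_mono_AE)
    show "AE x in M. x \<in> {x \<in> space M. h n x \<noteq> lim (\<lambda>n. h n x)} \<longrightarrow> x \<in> (\<Union>k. A (n + k))"
      using ev AE_space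
    proof eventually_elim
      case (elim x)
      show ?case
      proof
      assume x: "x \<in> {x \<in> space M. h n x \<noteq> lim (\<lambda>n. h n x)}"
      obtain N where N: "\<And>k. k \<ge> N \<Longrightarrow> h k x = lim (\<lambda>n. h n x)"
        using elim by (auto simp: eventually_sequentially)
      show "x \<in> (\<Union>k. A (n + k))"
      proof (rule ccontr)
        assume "x \<notin> (\<Union>k. A (n + k))"
        then have st: "h (n + k) x = h (Suc (n + k)) x" for k using elim by (auto simp: A_def)
        have "h (n + k) x = h n x" for k by (induction k) (simp_all add: st[symmetric])
        from this[of N] N[of "n + N"] x show False by simp
      qed
      qed
    qed
  qed auto
  also have "\<dots> \<le> (\<Sum>k. measure M (A (n + k)))"
    by (rule finite_measure_subadditive_countably) (auto simp: summ)
  also have "\<dots> \<le> (\<Sum>k. m (n + k) - m (Suc (n + k)))"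
    using step by (intro suminf_le summ sums_summable[OF tele]) (auto simp: A_def)
  also have "\<dots> = m n - l" using tele by (rule sums_unique[symmetric])
  finally show "measure M {x \<in> space M. h n x \<noteq> lim (\<lambda>n. h n x)} \<le> m n - l" .
qed

text \<open>
  A countable substitute for Zorn's lemma: a real-valued measure of progress cannot decrease by a
  fixed amount infinitely often.
\<close>
lemma maximal_of_chain_closed:
  fixes P :: "'k \<Rightarrow> bool" and R :: "'k \<Rightarrow> 'k \<Rightarrow> bool" and \<mu> :: "'k \<Rightarrow> real"
  assumes start: "P K0"
    and nonneg: "\<And>K. P K \<Longrightarrow> 0 \<le> \<mu> K"
    and refl: "\<And>K. P K \<Longrightarrow> R K K"
    and dec: "\<And>K L. R K L \<Longrightarrow> \<mu> L \<le> \<mu> K"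
    and trans: "\<And>K L N. R K L \<Longrightarrow> R L N \<Longrightarrow> R K N"
    and chain: "\<And>k. (\<And>n. P (k n)) \<Longrightarrow> (\<And>n. R (k n) (k (Suc n))) \<Longrightarrow> \<exists>L. P L \<and> (\<forall>n. R (k n) L)"
  obtains K where "P K" "\<And>L. P L \<Longrightarrow> R K L \<Longrightarrow> \<mu> L = \<mu> K"
proof -
  define S where "S K = {\<mu> L | L. P L \<and> R K L}" for K
  have bdd: "bdd_below (S K)" for K by (rule bdd_belowI[of _ 0]) (auto simp: S_def nonneg)
  \<comment> \<open>Each step realises at least half of the decrease that is still possible.\<close>
  have next_ex: "\<exists>L. (P L \<and> R K L) \<and> \<mu> L \<le> (\<mu> K + Inf (S K)) / 2" if K: "P K" for K
  proof (cases "Inf (S K) = \<mu> K")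
    case True
    then show ?thesis using refl[OF K] K by (intro exI[of _ K]) auto
  next
    case False
    have "\<mu> K \<in> S K" using K refl[OF K] by (auto simp: S_def)
    then have "Inf (S K) \<le> \<mu> K" "S K \<noteq> {}" by (auto intro: cInf_lower bdd)
    with False have "Inf (S K) < (\<mu> K + Inf (S K)) / 2" by simp
    then obtain z where "z \<in> S K" "z < (\<mu> K + Inf (S K)) / 2"
      using cInf_lessD[OF \<open>S K \<noteq> {}\<close>] by blast
    then show ?thesis by (auto simp: S_def)
  qed
  have "\<exists>k. \<forall>n. P (k n) \<and> (R (k n) (k (Suc n)) \<and> \<mu> (k (Suc n)) \<le> (\<mu> (k n) + Inf (S (k n))) / 2)"
    by (rule dependent_nat_choice) (use start next_ex in blast)+
  then obtain k where k: "P (k n)" "R (k n) (k (Suc n))" 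
    "\<mu> (k (Suc n)) \<le> (\<mu> (k n) + Inf (S (k n))) / 2" for n
    by blast
  obtain L where L: "P L" "\<And>n. R (k n) L" using chain k(1,2) by blast
  have "\<mu> N = \<mu> L" if N: "P N" "R L N" for N
  proof (rule ccontr)
    assume "\<mu> N \<noteq> \<mu> L"
    then have less: "\<mu> N < \<mu> L" using dec[OF N(2)] by simp
    \<comment> \<open>An improvement of the limit would improve every \<open>k n\<close> by at least the same amount.\<close>
    have step: "\<mu> (k (Suc n)) \<le> \<mu> (k n) - (\<mu> L - \<mu> N) / 2" for n
    proof -
      have "Inf (S (k n)) \<le> \<mu> N"
        using N trans[OF L(2) N(2)] by (intro cInf_lower bdd) (auto simp: S_def)
      then show ?thesis using k(3)[of n] dec[OF L(2)[of n]] by (simp add: field_simps)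
    qed
    have bound: "\<mu> (k n) \<le> \<mu> (k 0) - real n * ((\<mu> L - \<mu> N) / 2)" for n
    proof (induction n)
      case (Suc n)
      then show ?case using step[of n] by (simp add: field_simps)
    qed simp
    obtain n where "\<mu> (k 0) < real n * ((\<mu> L - \<mu> N) / 2)"
      using less by (metis ex_less_of_nat_mult diff_gt_0_iff_gt half_gt_zero)
    then show False using bound[of n] nonneg[OF k(1)[of n]] by simp
  qed
  then show ?thesis using that L(1) by blast
qed

section \<open>Automorphisms modulo null sets\<close>

text \<open>
  The inverse is kept as a second map, so that no exceptional null sets have to be named. Composition
  and limits can then be treated for both maps in the same way.
\<close>
definition automorphism :: "'a measure \<Rightarrow> ('a \<Rightarrow> 'a) \<Rightarrow> ('a \<Rightarrow> 'a) \<Rightarrow> bool" where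
  "automorphism M T T' \<longleftrightarrow> T \<in> M \<rightarrow>\<^sub>M M \<and> T' \<in> M \<rightarrow>\<^sub>M M \<and> distr M M T = M \<and> distr M M T' = M \<and>
     (AE x in M. T' (T x) = x) \<and> (AE x in M. T (T' x) = x)"

lemma automorphism_id: "automorphism M (\<lambda>x. x) (\<lambda>x. x)"
  by (simp add: automorphism_def distr_id)

lemma AE_preimage:
  assumes "T \<in> M \<rightarrow>\<^sub>M M" "distr M M T = M" "AE x in M. P x"
  shows "AE x in M. P (T x)"
proof (rule AE_distrD[OF assms(1)])
  show "AE x in distr M M T. P x" unfolding assms(2) by (rule assms(3))
qed

lemma measure_preimage:
  assumes "T \<in> M \<rightarrow>\<^sub>M M" "distr M M T = M" "A \<in> sets M"
  shows "measure M {x \<in> space M. T x \<in> A} = measure M A"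
proof -
  have "measure M A = measure (distr M M T) A" using assms by simp
  also have "\<dots> = measure M (T -` A \<inter> space M)" using assms by (subst measure_distr) auto
  also have "T -` A \<inter> space M = {x \<in> space M. T x \<in> A}" by auto
  finally show ?thesis by simp
qed

lemma automorphism_comp:
  assumes "automorphism M T T'" "automorphism M S S'"
  shows "automorphism M (S \<circ> T) (T' \<circ> S')"
proof -
  note T = assms(1)[unfolded automorphism_def] and S = assms(2)[unfolded automorphism_def]
  have d1: "distr M M (S \<circ> T) = M"
    using distr_distr[of S M M T M] T S by simp
  have d2: "distr M M (T' \<circ> S') = M"
    using distr_distr[of T' M M S' M] T S by simp
  have "AE x in M. S' (S (T x)) = T x"
    by (rule AE_preimage[where P = "\<lambda>y. S' (S y) = y"]) (use T S in blast)+
  moreover have "AE x in M. T' (T x) = x" using T by blast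
  ultimately have i1: "AE x in M. (T' \<circ> S') ((S \<circ> T) x) = x"
    by eventually_elim simp
  have "AE x in M. T (T' (S' x)) = S' x"
    by (rule AE_preimage[where P = "\<lambda>y. T (T' y) = y"]) (use T S in blast)+
  moreover have "AE x in M. S (S' x) = x" using S by blast
  ultimately have i2: "AE x in M. (S \<circ> T) ((T' \<circ> S') x) = x"
    by eventually_elim simp
  have "S \<circ> T \<in> M \<rightarrow>\<^sub>M M" "T' \<circ> S' \<in> M \<rightarrow>\<^sub>M M"
    using T S measurable_comp by blast+
  then show ?thesis using d1 d2 i1 i2 unfolding automorphism_def by blast
qed

text \<open>
  The indicator functions of the preimages of a set converge almost everywhere, and dominated
  convergence applies to them.
\<close>
lemma (in prob_space) distr_eventually_limit:
  assumes T: "\<And>n. T n \<in> M \<rightarrow>\<^sub>M M" "\<And>n. distr M M (T n) = M"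
    and S: "S \<in> M \<rightarrow>\<^sub>M M" "AE x in M. eventually (\<lambda>n. T n x = S x) sequentially"
  shows "distr M M S = M"
proof (rule measure_eqI)
  fix E assume "E \<in> sets (distr M M S)"
  then have E [measurable]: "E \<in> sets M" by simp
  note [measurable] = T(1) S(1)
  have int: "(\<integral>x. indicator E (U x) \<partial>M) = measure M {x \<in> space M. U x \<in> E}" 
    if [measurable]: "U \<in> M \<rightarrow>\<^sub>M M" for U
  proof -
    have "(\<integral>x. indicat_real E (U x) \<partial>M) = (\<integral>x. indicator {x \<in> space M. U x \<in> E} x \<partial>M)"
      by (rule Bochner_Integration.integral_cong) (auto simp: indicator_def)
    then show ?thesis by simp
  qed
  have "(\<lambda>n. \<integral>x. indicator E (T n x) \<partial>M) \<longlonglongrightarrow> (\<integral>x. indicator E (S x) \<partial>M :: real)"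
  proof (rule integral_dominated_convergence[where w = "\<lambda>_. 1"])
    show "AE x in M. (\<lambda>n. indicator E (T n x)) \<longlonglongrightarrow> (indicator E (S x) :: real)"
      using S(2)
    proof eventually_elim
      case (elim x)
      then have "eventually (\<lambda>n. indicat_real E (T n x) = indicator E (S x)) sequentially"
        by (rule eventually_mono) simp
      then show ?case by (rule tendsto_eventually)
    qed
  qed auto
  then have "(\<lambda>n. measure M E) \<longlonglongrightarrow> measure M {x \<in> space M. S x \<in> E}"
    unfolding int[OF T(1)] int[OF S(1)] measure_preimage[OF T E] .
  then have "measure M E = measure M {x \<in> space M. S x \<in> E}"
    by (simp add: LIMSEQ_const_iff)
  also have "{x \<in> space M. S x \<in> E} = S -` E \<inter> space M" by auto
  finally show "emeasure (distr M M S) E = emeasure M E"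
    by (subst emeasure_distr) (auto simp: emeasure_eq_measure)
qed simp

text \<open>
  The points where one map inverts the other form sets \<open>X\<close> and \<open>Y\<close> of full measure between which
  both maps are bijections, whatever they do elsewhere.
\<close>
lemma measure_preserving_mod0_of_automorphism:
  fixes M :: "'a measure"
  assumes aut: "automorphism M T T'"
    and [measurable]: "{x \<in> space M. T' (T x) = x} \<in> sets M" "{x \<in> space M. T (T' x) = x} \<in> sets M"
  shows "measure_preserving_mod0 M M T"
proof -
  define X where "X = {x \<in> space M. T' (T x) = x}"
  define Y where "Y = {x \<in> space M. T (T' x) = x}"
  have T: "T \<in> M \<rightarrow>\<^sub>M M" "T' \<in> M \<rightarrow>\<^sub>M M" "distr M M T' = M"
    "AE x in M. T' (T x) = x" "AE x in M. T (T' x) = x"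
    using aut unfolding automorphism_def by - (elim conjE, assumption)+
  have XY: "X \<in> sets M" "Y \<in> sets M" "X \<subseteq> space M" "Y \<subseteq> space M" by (auto simp: X_def Y_def)
  have null: "space M - X \<in> null_sets M" "space M - Y \<in> null_sets M"
  proof -
    have "AE x in M. x \<notin> space M - X" "AE x in M. x \<notin> space M - Y"
      using T(4,5) by (auto elim!: eventually_mono simp: X_def Y_def)
    then show "space M - X \<in> null_sets M" "space M - Y \<in> null_sets M"
      using XY by (simp_all add: AE_iff_null_sets)
  qed
  have diff: "space M - (space M - X) = X" "space M - (space M - Y) = Y" using XY by auto
  have TX: "T x \<in> Y" "T' (T x) = x" if "x \<in> X" for x
    using that measurable_space[OF T(1)] by (auto simp: X_def Y_def)
  have TY: "T' y \<in> X" "T (T' y) = y" if "y \<in> Y" for y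
    using that measurable_space[OF T(2)] by (auto simp: X_def Y_def)
  have bij: "bij_betw T X Y"
    by (rule bij_betw_byWitness[of _ T']) (use TX TY in auto)
  have inv: "the_inv_into X T y = T' y" if "y \<in> Y" for y
    using that TY[OF that] bij by (intro the_inv_into_f_eq) (auto simp: bij_betw_def)
  have mT: "T \<in> restrict_space M X \<rightarrow>\<^sub>M restrict_space M Y"
    using TX XY T(1) by (intro measurable_restrict_space3) auto
  have "T' \<in> restrict_space M Y \<rightarrow>\<^sub>M restrict_space M X"
    using TY XY T(2) by (intro measurable_restrict_space3) auto
  moreover have "the_inv_into X T \<in> restrict_space M Y \<rightarrow>\<^sub>M restrict_space M X
      \<longleftrightarrow> T' \<in> restrict_space M Y \<rightarrow>\<^sub>M restrict_space M X"
    by (rule measurable_cong) (use inv XY in \<open>auto simp: space_restrict_space\<close>)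
  ultimately have mT': "the_inv_into X T \<in> restrict_space M Y \<rightarrow>\<^sub>M restrict_space M X" by simp
  have meas: "emeasure M (T ` A) = emeasure M A" if A: "A \<in> sets M" "A \<subseteq> X" for A
  proof -
    have img: "T ` A = Y \<inter> (T' -` A \<inter> space M)"
    proof (intro equalityI subsetI)
      fix y assume "y \<in> T ` A"
      then obtain x where "x \<in> A" "y = T x" by blast
      then have "y \<in> Y" "T' y \<in> A" using TX[of x] A(2) by auto
      then show "y \<in> Y \<inter> (T' -` A \<inter> space M)" using XY(4) by auto
    next
      fix y assume "y \<in> Y \<inter> (T' -` A \<inter> space M)"
      then show "y \<in> T ` A" using TY(2)[of y] by (intro image_eqI[of _ _ "T' y"]) auto
    qed
    have "emeasure M (T ` A) = emeasure M (T' -` A \<inter> space M)"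
      unfolding img
    proof (rule emeasure_eq_AE)
      show "AE x in M. x \<in> Y \<inter> (T' -` A \<inter> space M) \<longleftrightarrow> x \<in> T' -` A \<inter> space M"
        using T(5) AE_space by eventually_elim (auto simp: Y_def)
    qed (use XY A T(2) in measurable)
    also have "\<dots> = emeasure (distr M M T') A" using A T(2) by (simp add: emeasure_distr)
    also have "\<dots> = emeasure M A" by (simp add: T(3))
    finally show ?thesis .
  qed
  show ?thesis
    unfolding measure_preserving_mod0_def
    by (rule bexI[OF _ null(1)], rule bexI[OF _ null(2)], unfold diff)
       (intro conjI ballI impI bij mT mT' meas)
qed

section \<open>Castles\<close>

text \<open>
  The two properties of Lebesgue measure that the construction uses: sets of equal measure can be
  exchanged by an involution, and sets of intermediate measure exist.
\<close>
locale homogeneous_interval = prob_space M for M :: "real measure" +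
  assumes sets_eq: "sets M = sets (restrict_space borel {0..1})"
    and swap: "\<And>B C. B \<in> sets M \<Longrightarrow> C \<in> sets M \<Longrightarrow> B \<inter> C = {} \<Longrightarrow> measure M B = measure M C \<Longrightarrow>
      \<exists>s \<in> borel_measurable borel. automorphism M s s \<and>
        (AE x in M. (x \<in> B \<longrightarrow> s x \<in> C) \<and> (x \<in> C \<longrightarrow> s x \<in> B)) \<and> (\<forall>x. x \<notin> B \<union> C \<longrightarrow> s x = x)"
    and between: "\<And>E G m. E \<in> sets M \<Longrightarrow> G \<in> sets M \<Longrightarrow> E \<subseteq> G \<Longrightarrow> measure M E \<le> m \<Longrightarrow> m \<le> measure M G \<Longrightarrow>
      \<exists>H \<in> sets M. E \<subseteq> H \<and> H \<subseteq> G \<and> measure M H = m"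

text \<open>
  The data of a stage. The map \<open>shift\<close> climbs a tower and returns from its top to its base point.
  The function \<open>base_sum\<close> is the sum over the tower at a base point and \<open>0\<close> elsewhere, so the base need
  not be stored: it is where \<open>base_sum\<close> does not vanish, and towers with sum \<open>0\<close> count as finished.
  The value of \<open>base_point\<close> is the base point of the tower through a given point. Values outside
  \<open>{0..1}\<close> are permitted; in a limit they mark the points whose towers were extended infinitely
  often and have no base point any more.
\<close>
record castle =
  shift :: "real \<Rightarrow> real"
  shift_inv :: "real \<Rightarrow> real"
  base_sum :: "real \<Rightarrow> real"
  base_point :: "real \<Rightarrow> real"
  potential :: "real \<Rightarrow> real"

context homogeneous_interval
begin

lemma space_eq: "space M = {0..1}"
  using sets_eq_imp_space_eq[OF sets_eq] by (simp add: space_restrict_space)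

lemma measurable_from_borel: "h \<in> borel_measurable borel \<Longrightarrow> h \<in> borel_measurable M"
  unfolding measurable_cong_sets[OF sets_eq refl] by (rule measurable_restrict_space1)

lemma sets_borel: "A \<in> sets M \<Longrightarrow> A \<in> sets borel \<and> A \<subseteq> {0..1}"
  unfolding sets_eq by (auto simp: sets_restrict_space)

lemma measurable_M_iff: "h \<in> M \<rightarrow>\<^sub>M M \<longleftrightarrow> h \<in> borel_measurable M \<and> (\<forall>x \<in> {0..1}. h x \<in> {0..1})"
proof -
  have "M \<rightarrow>\<^sub>M M = M \<rightarrow>\<^sub>M restrict_space borel {0..1}"
    by (rule measurable_cong_sets[OF refl sets_eq])
  then show ?thesis
    by (simp only: measurable_restrict_space2_iff space_eq Pi_iff)
qed

lemma measurable_to_borel: "h \<in> M \<rightarrow>\<^sub>M M \<Longrightarrow> h \<in> borel_measurable M"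
  by (simp only: measurable_M_iff)

text \<open>
  The condition that quantifies over \<open>P\<close> says that \<open>base_point\<close> is nonsingular: properties that hold
  almost everywhere on the base hold at the base points of almost all towers. The last condition is
  the room for shifting that keeps \<open>potential\<close> bounded. It is written with the values of \<open>base_sum\<close> at
  almost every \<open>y\<close> instead of the essential bounds of \<open>base_sum\<close>, because this form passes to limits
  directly, while the essential bounds change from stage to stage.
\<close>
definition castle_for :: "(real \<Rightarrow> real) \<Rightarrow> real \<Rightarrow> castle \<Rightarrow> bool" where
  "castle_for f c K \<longleftrightarrow>
     automorphism M (shift K) (shift_inv K) \<and>
     base_sum K \<in> borel_measurable borel \<and>
     (\<forall>x. x \<notin> {0..1} \<longrightarrow> base_sum K x = 0) \<and>
     base_point K \<in> borel_measurable M \<and>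
     potential K \<in> borel_measurable M \<and>
     (AE x in M. f x = potential K (shift K x) - potential K x + base_sum K (shift K x)) \<and>
     (AE x in M. base_point K (shift K x) = base_point K x) \<and>
     (AE x in M. base_sum K x \<noteq> 0 \<longrightarrow> base_point K x = x \<and> potential K x = 0) \<and>
     (\<forall>P. (AE x in M. P x) \<longrightarrow> (AE x in M. base_point K x \<in> {0..1} \<longrightarrow> P (base_point K x))) \<and>
     (AE x in M. \<bar>base_sum K x\<bar> \<le> c \<and> \<bar>potential K x\<bar> \<le> c) \<and>
     (AE x in M. AE y in M.
        (base_sum K (base_point K x) > 0 \<and> base_sum K y < 0 \<longrightarrow> - c - base_sum K y \<le> potential K x) \<and>
        (base_sum K (base_point K x) < 0 \<and> base_sum K y > 0 \<longrightarrow> potential K x \<le> c - base_sum K y))"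

definition base_mass :: "castle \<Rightarrow> real" where
  "base_mass K = measure M {x \<in> space M. base_sum K x \<noteq> 0}"

definition discrepancy :: "(real \<Rightarrow> real) \<Rightarrow> (real \<Rightarrow> real) \<Rightarrow> real" where
  "discrepancy h k = measure M {x \<in> space M. h x \<noteq> k x}"

text \<open>
  When towers over \<open>C\<close> are put on top of towers over a set \<open>B\<close> of the same measure, the changes take
  place over \<open>B \<union> C\<close> and \<open>C\<close> leaves the base; this explains the factor \<open>2\<close>. The estimate adds up along
  a chain, so it bounds all changes after a given stage by what is left of the base. There is no such
  estimate for \<open>potential\<close>, which changes on whole towers.
\<close>
definition extends :: "castle \<Rightarrow> castle \<Rightarrow> bool" where
  "extends K L \<longleftrightarrow>
     discrepancy (shift K) (shift L) \<le> 2 * (base_mass K - base_mass L) \<and>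
     discrepancy (shift_inv K) (shift_inv L) \<le> 2 * (base_mass K - base_mass L) \<and>
     discrepancy (base_sum K) (base_sum L) \<le> 2 * (base_mass K - base_mass L)"

lemma castle_forD:
  assumes "castle_for f c K"
  shows "automorphism M (shift K) (shift_inv K)"
    and "base_sum K \<in> borel_measurable borel"
    and "\<forall>x. x \<notin> {0..1} \<longrightarrow> base_sum K x = 0"
    and "base_point K \<in> borel_measurable M"
    and "potential K \<in> borel_measurable M"
    and "AE x in M. f x = potential K (shift K x) - potential K x + base_sum K (shift K x)"
    and "AE x in M. base_point K (shift K x) = base_point K x"
    and "AE x in M. base_sum K x \<noteq> 0 \<longrightarrow> base_point K x = x \<and> potential K x = 0"
    and "\<forall>P. (AE x in M. P x) \<longrightarrow> (AE x in M. base_point K x \<in> {0..1} \<longrightarrow> P (base_point K x))"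
    and "AE x in M. \<bar>base_sum K x\<bar> \<le> c \<and> \<bar>potential K x\<bar> \<le> c"
    and "AE x in M. AE y in M.
        (base_sum K (base_point K x) > 0 \<and> base_sum K y < 0 \<longrightarrow> - c - base_sum K y \<le> potential K x) \<and>
        (base_sum K (base_point K x) < 0 \<and> base_sum K y > 0 \<longrightarrow> potential K x \<le> c - base_sum K y)"
  using assms unfolding castle_for_def by - (elim conjE, assumption)+

lemma castle_forI:
  assumes "automorphism M (shift K) (shift_inv K)"
    and "base_sum K \<in> borel_measurable borel"
    and "\<forall>x. x \<notin> {0..1} \<longrightarrow> base_sum K x = 0"
    and "base_point K \<in> borel_measurable M"
    and "potential K \<in> borel_measurable M"
    and "AE x in M. f x = potential K (shift K x) - potential K x + base_sum K (shift K x)"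
    and "AE x in M. base_point K (shift K x) = base_point K x"
    and "AE x in M. base_sum K x \<noteq> 0 \<longrightarrow> base_point K x = x \<and> potential K x = 0"
    and "\<forall>P. (AE x in M. P x) \<longrightarrow> (AE x in M. base_point K x \<in> {0..1} \<longrightarrow> P (base_point K x))"
    and "AE x in M. \<bar>base_sum K x\<bar> \<le> c \<and> \<bar>potential K x\<bar> \<le> c"
    and "AE x in M. AE y in M.
        (base_sum K (base_point K x) > 0 \<and> base_sum K y < 0 \<longrightarrow> - c - base_sum K y \<le> potential K x) \<and>
        (base_sum K (base_point K x) < 0 \<and> base_sum K y > 0 \<longrightarrow> potential K x \<le> c - base_sum K y)"
  shows "castle_for f c K"
  unfolding castle_for_def by (intro conjI assms)

lemma castle_for_measurable:
  assumes "castle_for f c K"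
  shows "shift K \<in> M \<rightarrow>\<^sub>M M" "shift_inv K \<in> M \<rightarrow>\<^sub>M M"
    and "shift K \<in> borel_measurable M" "shift_inv K \<in> borel_measurable M" "base_sum K \<in> borel_measurable M"
proof -
  show "shift K \<in> M \<rightarrow>\<^sub>M M" "shift_inv K \<in> M \<rightarrow>\<^sub>M M"
    using castle_forD(1)[OF assms] unfolding automorphism_def by - (elim conjE, assumption)+
  then show "shift K \<in> borel_measurable M" "shift_inv K \<in> borel_measurable M"
    by - (rule measurable_to_borel, assumption)+
  show "base_sum K \<in> borel_measurable M"
    by (rule measurable_from_borel[OF castle_forD(2)[OF assms]])
qed

lemma discrepancy_triangle:
  assumes [measurable]: "h \<in> borel_measurable M" "k \<in> borel_measurable M" "l \<in> borel_measurable M"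
  shows "discrepancy h l \<le> discrepancy h k + discrepancy k l"
proof -
  have "discrepancy h l \<le> measure M ({x \<in> space M. h x \<noteq> k x} \<union> {x \<in> space M. k x \<noteq> l x})"
    unfolding discrepancy_def by (rule finite_measure_mono) auto
  also have "\<dots> \<le> discrepancy h k + discrepancy k l"
    unfolding discrepancy_def by (rule measure_Un_le) auto
  finally show ?thesis .
qed

lemma extends_refl: "extends K K"
  by (simp add: extends_def discrepancy_def)

lemma base_mass_nonneg: "0 \<le> base_mass K"
  by (simp add: base_mass_def)

lemma extends_base_mass:
  assumes "extends K L"
  shows "base_mass L \<le> base_mass K"
proof -
  have "0 \<le> discrepancy (base_sum K) (base_sum L)" by (simp add: discrepancy_def)
  also have "\<dots> \<le> 2 * (base_mass K - base_mass L)" using assms by (simp add: extends_def)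
  finally show ?thesis by simp
qed

lemma extends_trans:
  assumes "castle_for f c K" "castle_for f c L" "castle_for f c N" and KL: "extends K L" "extends L N"
  shows "extends K N"
proof -
  note m = assms(1-3)[THEN castle_for_measurable(3)] assms(1-3)[THEN castle_for_measurable(4)]
    assms(1-3)[THEN castle_for_measurable(5)]
  have "discrepancy (shift K) (shift N) \<le> 2 * (base_mass K - base_mass N)"
    using KL discrepancy_triangle[OF m(1-3)] unfolding extends_def by simp
  moreover have "discrepancy (shift_inv K) (shift_inv N) \<le> 2 * (base_mass K - base_mass N)"
    using KL discrepancy_triangle[OF m(4-6)] unfolding extends_def by simp
  moreover have "discrepancy (base_sum K) (base_sum N) \<le> 2 * (base_mass K - base_mass N)"
    using KL discrepancy_triangle[OF m(7-9)] unfolding extends_def by simp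
  ultimately show ?thesis unfolding extends_def by blast
qed

text \<open>
  The same towers, seen from \<open>-f\<close>: the positive and the negative towers exchange their roles.
\<close>
definition negate :: "castle \<Rightarrow> castle" where
  "negate K = \<lparr>shift = shift K, shift_inv = shift_inv K, base_sum = \<lambda>x. - base_sum K x,
     base_point = base_point K, potential = \<lambda>x. - potential K x\<rparr>"

lemma negate_negate: "negate (negate K) = K"
  by (cases K) (simp add: negate_def)

lemma base_mass_negate: "base_mass (negate K) = base_mass K"
  by (simp add: base_mass_def negate_def)

lemma extends_negate: "extends (negate K) (negate L) \<longleftrightarrow> extends K L"
  unfolding extends_def base_mass_negate by (simp add: negate_def discrepancy_def)

lemma castle_for_negate:
  assumes "castle_for f c K"
  shows "castle_for (\<lambda>x. - f x) c (negate K)"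
proof -
  note K = castle_forD[OF assms]
  have eq: "AE x in M. - f x = - potential K (shift K x) - - potential K x + - base_sum K (shift K x)"
    using K(6) by eventually_elim simp
  have win: "AE x in M. AE y in M.
      (- base_sum K (base_point K x) > 0 \<and> - base_sum K y < 0 \<longrightarrow> - c - - base_sum K y \<le> - potential K x) \<and>
      (- base_sum K (base_point K x) < 0 \<and> - base_sum K y > 0 \<longrightarrow> - potential K x \<le> c - - base_sum K y)"
    using K(11)
  proof eventually_elim
    case (elim x)
    then show ?case by eventually_elim linarith
  qed
  have base: "AE x in M. - base_sum K x \<noteq> 0 \<longrightarrow> base_point K x = x \<and> - potential K x = 0"
    using K(8) by simp
  have bd: "AE x in M. \<bar>- base_sum K x\<bar> \<le> c \<and> \<bar>- potential K x\<bar> \<le> c"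
    using K(10) by simp
  have m: "(\<lambda>x. - base_sum K x) \<in> borel_measurable borel" "(\<lambda>x. - potential K x) \<in> borel_measurable M"
    using K(2,5) by simp_all
  have off: "\<forall>x. x \<notin> {0..1} \<longrightarrow> - base_sum K x = 0"
    using K(3) by simp
  note facts = K(1) m(1) off K(4) m(2) eq K(7) base K(9) bd win
  show ?thesis
    by (rule castle_forI; unfold negate_def castle.select_convs) (fact facts)+
qed

section \<open>Stacking towers\<close>

text \<open>
  For \<open>x \<in> B\<close> the tower over \<open>s x \<in> C\<close> is put on top of the tower over \<open>x\<close>. Say \<open>F x > 0\<close>; then the
  upper tower is negative, its potential is at most \<open>c - a\<close> and is raised by \<open>F x \<le> a\<close>, so it stays
  below \<open>c\<close>. It ends up above \<open>-c + F x\<close>, which is why \<open>F x\<close> has to reach the new bound \<open>b'\<close>. As \<open>F x\<close>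
  dominates, the combined sum is not negative and no upper window has to be respected.
\<close>
lemma stack_towers:
  fixes f c K s a b a' b'
  defines "F \<equiv> base_sum K" and "p \<equiv> base_point K" and "g \<equiv> potential K"
  assumes K: "castle_for f c K"
    and bounds: "AE x in M. - b \<le> F x \<and> F x \<le> a"
    and window: "AE x in M. (F (p x) > 0 \<longrightarrow> - c + b \<le> g x) \<and> (F (p x) < 0 \<longrightarrow> g x \<le> c - a)"
    and s: "s \<in> borel_measurable borel" "automorphism M s s"
    and BC: "B \<in> sets M" "C \<in> sets M" "B \<inter> C = {}"
    and move: "AE x in M. (x \<in> B \<longrightarrow> s x \<in> C) \<and> (x \<in> C \<longrightarrow> s x \<in> B)" "\<And>x. x \<notin> B \<union> C \<Longrightarrow> s x = x"
    and ab: "a' \<le> a" "b' \<le> b"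
    and dominate: "AE x in M. x \<in> B \<longrightarrow> F x * F (s x) < 0 \<and> \<bar>F (s x)\<bar> \<le> \<bar>F x\<bar> \<and>
      (F x > 0 \<longrightarrow> b' \<le> F x) \<and> (F x < 0 \<longrightarrow> a' \<le> - F x)"
    and bounds': "AE x in M. (x \<in> B \<longrightarrow> - b' \<le> F x + F (s x) \<and> F x + F (s x) \<le> a') \<and>
      (x \<notin> B \<union> C \<longrightarrow> - b' \<le> F x \<and> F x \<le> a')"
    and pos: "0 \<le> a'" "0 \<le> b'"
  shows "\<exists>L. castle_for f c L \<and> extends K L \<and> base_mass L + measure M C \<le> base_mass K"
proof -
  define T where "T = shift K"
  define T' where "T' = shift_inv K"
  note KD = castle_forD[OF K, folded F_def p_def g_def T_def T'_def]
  define F' where "F' x = (if x \<in> B then F x + F (s x) else if x \<in> C then 0 else F x)" for x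
  define q where "q y = (if y \<in> C then s y else y)" for y
  define g' where "g' x = (if p x \<in> C then g x + F (s (p x)) else g x)" for x
  define L where "L = \<lparr>shift = s \<circ> T, shift_inv = T' \<circ> s, base_sum = F',
      base_point = \<lambda>x. q (p x), potential = g'\<rparr>"
  have B01: "B \<in> sets borel" "B \<subseteq> {0..1}" and C01: "C \<in> sets borel" "C \<subseteq> {0..1}"
    using BC sets_borel by auto
  have disj: "x \<notin> C" if "x \<in> B" for x using that BC(3) by blast
  note [measurable] = s(1) B01(1) C01(1) KD(2,4,5)
  have sM: "s \<in> M \<rightarrow>\<^sub>M M" "distr M M s = M" "AE x in M. s (s x) = x"
    using s(2) by (auto simp: automorphism_def)
  have TM: "T \<in> M \<rightarrow>\<^sub>M M" "distr M M T = M"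
    using KD(1) by (auto simp: automorphism_def)
  have at_s: "AE x in M. P (s x)" if "AE x in M. P x" for P
    using AE_preimage[OF sM(1,2) that] .
  have at_T: "AE x in M. P (T x)" if "AE x in M. P x" for P
    using AE_preimage[OF TM that] .
  \<comment> \<open>What holds at almost every point of the base.\<close>
  define good where "good y \<longleftrightarrow> s (s y) = y \<and> (y \<in> B \<longrightarrow> s y \<in> C) \<and> (y \<in> C \<longrightarrow> s y \<in> B) \<and>
      - b \<le> F y \<and> F y \<le> a \<and> - b \<le> F (s y) \<and> F (s y) \<le> a \<and>
      (F y \<noteq> 0 \<longrightarrow> p y = y \<and> g y = 0) \<and> (F (s y) \<noteq> 0 \<longrightarrow> p (s y) = s y \<and> g (s y) = 0) \<and>
      (\<forall>x \<in> B \<inter> {y, s y}. F x * F (s x) < 0 \<and> \<bar>F (s x)\<bar> \<le> \<bar>F x\<bar> \<and>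
          (F x > 0 \<longrightarrow> b' \<le> F x) \<and> (F x < 0 \<longrightarrow> a' \<le> - F x))" for y
  have good: "AE y in M. good y"
    using sM(3) move(1) bounds at_s[OF bounds] KD(8) at_s[OF KD(8)] dominate at_s[OF dominate]
    by eventually_elim (unfold good_def, blast)
  have good_B: "F y * F (s y) < 0" "\<bar>F (s y)\<bar> \<le> \<bar>F y\<bar>" "F y > 0 \<Longrightarrow> b' \<le> F y" "F y < 0 \<Longrightarrow> a' \<le> - F y"
      "s y \<in> C" "p y = y" "g y = 0" "p (s y) = s y" "g (s y) = 0" "s (s y) = y" "F y \<noteq> 0" "F (s y) \<noteq> 0"
    if "good y" "y \<in> B" for y
  proof -
    have "F y * F (s y) < 0 \<and> \<bar>F (s y)\<bar> \<le> \<bar>F y\<bar> \<and>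
        (F y > 0 \<longrightarrow> b' \<le> F y) \<and> (F y < 0 \<longrightarrow> a' \<le> - F y)"
      using that unfolding good_def by (metis IntI insertCI)
    moreover from this have "F y \<noteq> 0" "F (s y) \<noteq> 0" by auto
    ultimately show "F y * F (s y) < 0" "\<bar>F (s y)\<bar> \<le> \<bar>F y\<bar>"
      "F y > 0 \<Longrightarrow> b' \<le> F y" "F y < 0 \<Longrightarrow> a' \<le> - F y"
      "s y \<in> C" "p y = y" "g y = 0" "p (s y) = s y" "g (s y) = 0" "s (s y) = y" "F y \<noteq> 0" "F (s y) \<noteq> 0"
      using that unfolding good_def by simp_all
  qed
  have good_C: "F y * F (s y) < 0" "\<bar>F y\<bar> \<le> \<bar>F (s y)\<bar>" "F (s y) > 0 \<Longrightarrow> b' \<le> F (s y)" "F (s y) < 0 \<Longrightarrow> a' \<le> - F (s y)"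
      "s y \<in> B" "p y = y" "g y = 0" "p (s y) = s y" "g (s y) = 0" "s (s y) = y" "F y \<noteq> 0" "F (s y) \<noteq> 0"
    if "good y" "y \<in> C" for y
  proof -
    have *: "s y \<in> B" "s (s y) = y" using that unfolding good_def by blast+
    with that have "F (s y) * F y < 0 \<and> \<bar>F y\<bar> \<le> \<bar>F (s y)\<bar> \<and>
        (F (s y) > 0 \<longrightarrow> b' \<le> F (s y)) \<and> (F (s y) < 0 \<longrightarrow> a' \<le> - F (s y))"
      unfolding good_def by (metis IntI insertCI)
    moreover from this have "F y \<noteq> 0" "F (s y) \<noteq> 0" by auto
    ultimately show "F y * F (s y) < 0" "\<bar>F y\<bar> \<le> \<bar>F (s y)\<bar>"
      "F (s y) > 0 \<Longrightarrow> b' \<le> F (s y)" "F (s y) < 0 \<Longrightarrow> a' \<le> - F (s y)"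
      "s y \<in> B" "p y = y" "g y = 0" "p (s y) = s y" "g (s y) = 0" "s (s y) = y" "F y \<noteq> 0" "F (s y) \<noteq> 0"
      using that(1) * unfolding good_def by (simp_all add: mult.commute)
  qed
  have F'_meas [measurable]: "F' \<in> borel_measurable borel" unfolding F'_def by measurable
  have g'_meas: "g' \<in> borel_measurable M" unfolding g'_def by measurable
  have qp_meas: "(\<lambda>x. q (p x)) \<in> borel_measurable M" unfolding q_def by measurable
  have auto_L: "automorphism M (s \<circ> T) (T' \<circ> s)"
    using automorphism_comp[OF KD(1) s(2)] .
  \<comment> \<open>The point \<open>u\<close> is the old image of \<open>x\<close>, which is in the base exactly when \<open>x\<close> was the top of an unfinished tower.\<close>
  have cohom: "AE x in M. f x = g' (s (T x)) - g' x + F' (s (T x))"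
    using KD(6,7) at_T[OF good]
  proof eventually_elim
    case (elim x)
    define u where "u = T x"
    have f: "f x = g u - g x + F u" and pu: "p u = p x" and u: "good u" 
      using elim by (simp_all add: u_def)
    consider "u \<in> B" | "u \<in> C" | "u \<notin> B \<union> C" by blast
    then have "f x = g' (s u) - g' x + F' (s u)"
    proof cases
      case 1
      then show ?thesis using good_B[OF u 1] f pu disj by (auto simp: g'_def F'_def)
    next
      case 2
      then show ?thesis using good_C[OF u 2] f pu disj by (auto simp: g'_def F'_def)
    next
      case 3
      then show ?thesis using f pu move(2)[OF 3] by (auto simp: g'_def F'_def)
    qed
    then show ?case by (simp add: u_def)
  qed
  have inv: "AE x in M. q (p (s (T x))) = q (p x)"
    using KD(7) at_T[OF good]
  proof eventually_elim
    case (elim x)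
    define u where "u = T x"
    have pu: "p u = p x" and u: "good u" using elim by (simp_all add: u_def)
    consider "u \<in> B" | "u \<in> C" | "u \<notin> B \<union> C" by blast
    then have "q (p (s u)) = q (p x)"
    proof cases
      case 1
      then show ?thesis using good_B[OF u 1] pu disj by (auto simp: q_def)
    next
      case 2
      then show ?thesis using good_C[OF u 2] pu disj by (auto simp: q_def)
    next
      case 3
      then show ?thesis using pu move(2)[OF 3] by (auto simp: q_def)
    qed
    then show ?case by (simp add: u_def)
  qed
  have base: "AE x in M. F' x \<noteq> 0 \<longrightarrow> q (p x) = x \<and> g' x = 0"
    using good
  proof (eventually_elim, intro impI)
    fix x assume x: "good x" "F' x \<noteq> 0"
    then have "x \<notin> C" using disj by (auto simp: F'_def split: if_splits)
    moreover have "F x \<noteq> 0" using x good_B[of x] \<open>x \<notin> C\<close> by (auto simp: F'_def split: if_splits)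
    then have "p x = x" "g x = 0" using x(1) by (auto simp: good_def)
    ultimately show "q (p x) = x \<and> g' x = 0" by (simp add: q_def g'_def)
  qed
  have nonsing: "\<forall>P. (AE x in M. P x) \<longrightarrow> (AE x in M. q (p x) \<in> {0..1} \<longrightarrow> P (q (p x)))"
  proof (intro allI impI)
    fix P assume P: "AE x in M. P x"
    show "AE x in M. q (p x) \<in> {0..1} \<longrightarrow> P (q (p x))"
      using KD(9)[THEN spec, of P, THEN mp, OF P]
        KD(9)[THEN spec, of "\<lambda>x. P (s x)", THEN mp, OF at_s[of P, OF P]]
      by eventually_elim (use C01(2) in \<open>auto simp: q_def\<close>)
  qed
  have good_p: "AE x in M. p x \<in> {0..1} \<longrightarrow> good (p x)"
    using KD(9)[THEN spec, of good, THEN mp, OF good] .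
  have win': "AE x in M. \<bar>g' x\<bar> \<le> c \<and> (F' (q (p x)) > 0 \<longrightarrow> - c + b' \<le> g' x) \<and> (F' (q (p x)) < 0 \<longrightarrow> g' x \<le> c - a')"
    using good_p KD(10) window
  proof eventually_elim
    case (elim x)
    define y where "y = p x"
    consider "y \<in> B" | "y \<in> C" | "y \<notin> B \<union> C" by blast
    then show ?case
    proof cases
      case 1
      then have y: "good y" using elim B01 by (auto simp: y_def)
      have "q (p x) = y" "g' x = g x" "F' y = F y + F (s y)"
        using 1 disj by (auto simp: q_def g'_def F'_def y_def)
      moreover have "F' y > 0 \<Longrightarrow> F y > 0" "F' y < 0 \<Longrightarrow> F y < 0"
        using good_B(1,2)[OF y 1] calculation(3) by (auto simp: mult_less_0_iff)
      ultimately show ?thesis using elim ab by (auto simp: y_def)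
    next
      case 2
      then have y: "good y" using elim C01 by (auto simp: y_def)
      have eqs: "q (p x) = s y" "g' x = g x + F (s y)" "F' (s y) = F (s y) + F y"
        using 2 disj good_C(5,10)[OF y 2] by (auto simp: q_def g'_def F'_def y_def)
      have ran: "F (s y) \<le> a" "- b \<le> F (s y)" using y by (auto simp: good_def)
      show ?thesis
      proof (cases "F (s y) > 0")
        case True
        then have "F y < 0" using good_C(1)[OF y 2] by (auto simp: mult_less_0_iff)
        then have "g x \<le> c - a" "F' (s y) \<ge> 0" 
          using elim True good_C(2)[OF y 2] eqs(3) by (auto simp: y_def)
        then show ?thesis using elim eqs ran True good_C(3)[OF y 2] by auto
      next
        case False
        then have neg: "F (s y) < 0" using good_C(12)[OF y 2] by simp
        then have "F y > 0" using good_C(1)[OF y 2] by (auto simp: mult_less_0_iff)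
        then have "- c + b \<le> g x" "F' (s y) \<le> 0" 
          using elim neg good_C(2)[OF y 2] eqs(3) by (auto simp: y_def)
        then show ?thesis using elim eqs ran neg good_C(4)[OF y 2] by auto
      qed
    next
      case 3
      then have "q (p x) = y" "g' x = g x" "F' y = F y"
        by (auto simp: q_def g'_def F'_def y_def)
      then show ?thesis using elim ab by (auto simp: y_def)
    qed
  qed
  have F'c: "AE x in M. \<bar>F' x\<bar> \<le> c"
    using good KD(10)
  proof eventually_elim
    case (elim x)
    show ?case
    proof (cases "x \<in> B")
      case True
      then show ?thesis using good_B(1,2)[OF elim(1) True] elim(2) by (auto simp: F'_def mult_less_0_iff)
    qed (use elim in \<open>auto simp: F'_def\<close>)
  qed
  have F'b: "AE y in M. - b' \<le> F' y \<and> F' y \<le> a'"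
    using bounds' by eventually_elim (use pos in \<open>auto simp: F'_def\<close>)
  have win: "AE x in M. AE y in M.
      (F' (q (p x)) > 0 \<and> F' y < 0 \<longrightarrow> - c - F' y \<le> g' x) \<and>
      (F' (q (p x)) < 0 \<and> F' y > 0 \<longrightarrow> g' x \<le> c - F' y)"
    using win'
  proof eventually_elim
    case (elim x)
    show ?case using F'b by eventually_elim (use elim in auto)
  qed
  have castle: "castle_for f c L"
  proof -
    have bd: "AE x in M. \<bar>F' x\<bar> \<le> c \<and> \<bar>g' x\<bar> \<le> c"
      using F'c win' by eventually_elim simp
    have off: "\<forall>x. x \<notin> {0..1} \<longrightarrow> F' x = 0"
      using KD(3) B01(2) C01(2) by (auto simp: F'_def)
    note facts = auto_L[unfolded comp_def] F'_meas off qp_meas g'_meas cohom inv base nonsing bd win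
    show ?thesis
      by (rule castle_forI; unfold L_def castle.simps comp_def) (fact facts)+
  qed
  \<comment> \<open>Up to null sets \<open>B\<close> is the preimage of \<open>C\<close>, so each accounts for half of the changes.\<close>
  have eqBC: "measure M B = measure M C"
  proof -
    have "measure M B = measure M {x \<in> space M. s x \<in> C}"
    proof (rule finite_measure_eq_AE)
      show "AE x in M. x \<in> B \<longleftrightarrow> x \<in> {x \<in> space M. s x \<in> C}"
        using good AE_space
      proof eventually_elim
        case (elim x)
        show ?case
        proof (cases "x \<in> B \<union> C")
          case True
          then show ?thesis using good_B(5)[OF elim(1)] good_C(5)[OF elim(1)] disj elim(2) by auto
        qed (use move(2) in auto)
      qed
    qed (use BC sM(1) in measurable)
    then show ?thesis using measure_preimage[OF sM(1,2) BC(2)] by simp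
  qed
  have mUn: "measure M (B \<union> C) = 2 * measure M C"
    using eqBC BC by (subst finite_measure_Union) auto
  have mass: "base_mass L + measure M C \<le> base_mass K"
  proof -
    have [measurable]: "F' \<in> borel_measurable M" "F \<in> borel_measurable M"
      using measurable_from_borel F'_meas KD(2) by blast+
    define E where "E = {x \<in> space M. F' x \<noteq> 0}"
    have "E \<in> sets M" unfolding E_def by measurable
    moreover have "E \<inter> C = {}" using disj by (auto simp: E_def F'_def)
    ultimately have "base_mass L + measure M C = measure M (E \<union> C)"
      using BC by (subst finite_measure_Union) (auto simp: base_mass_def L_def E_def)
    also have "\<dots> \<le> measure M {x \<in> space M. F x \<noteq> 0}"
    proof (rule finite_measure_mono_AE)
      show "AE x in M. x \<in> E \<union> C \<longrightarrow> x \<in> {x \<in> space M. F x \<noteq> 0}"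
        using good AE_space
      proof eventually_elim
        case (elim x)
        then show ?case
          using good_B(11)[of x] good_C(11)[of x] by (auto simp: E_def F'_def split: if_splits)
      qed
    qed measurable
    finally show ?thesis by (simp add: base_mass_def F_def)
  qed
  have ext: "extends K L"
    unfolding extends_def
  proof (intro conjI)
    have "discrepancy (shift K) (shift L) \<le> measure M {x \<in> space M. T x \<in> B \<union> C}"
      unfolding discrepancy_def using TM BC move(2)
      by (intro finite_measure_mono) (auto simp: L_def T_def[symmetric])
    also have "\<dots> = measure M (B \<union> C)"
      using BC by (intro measure_preimage TM) auto
    finally show "discrepancy (shift K) (shift L) \<le> 2 * (base_mass K - base_mass L)"
      using mUn mass by simp
    have "discrepancy (shift_inv K) (shift_inv L) \<le> measure M (B \<union> C)"
      unfolding discrepancy_def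
      using BC move(2) by (intro finite_measure_mono) (auto simp: L_def T'_def[symmetric])
    then show "discrepancy (shift_inv K) (shift_inv L) \<le> 2 * (base_mass K - base_mass L)"
      using mUn mass by simp
    have "discrepancy (base_sum K) (base_sum L) \<le> measure M (B \<union> C)"
      unfolding discrepancy_def
      using BC by (intro finite_measure_mono) (auto simp: L_def F'_def F_def[symmetric])
    then show "discrepancy (base_sum K) (base_sum L) \<le> 2 * (base_mass K - base_mass L)"
      using mUn mass by simp
  qed
  show ?thesis using castle ext mass by blast
qed

section \<open>Limits of castles\<close>

text \<open>
  The transformation, its inverse and the tower sums are eventually constant almost everywhere, hence
  so is every equation between them. The potentials need not converge, but \<open>f x\<close> and the eventually
  constant tower sum determine the difference between their values at \<open>T x\<close> and \<open>x\<close>, so their upper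
  limit satisfies the same equation.
\<close>
lemma castle_chain_limit:
  assumes P: "\<And>n. castle_for f c (k n)" and ext: "\<And>n. extends (k n) (k (Suc n))"
  shows "\<exists>L. castle_for f c L \<and> (\<forall>n. extends (k n) L)"
proof -
  define m where "m n = base_mass (k n)" for n
  define F where "F n = base_sum (k n)" for n
  define T where "T n = shift (k n)" for n
  define Ti where "Ti n = shift_inv (k n)" for n
  define p where "p n = base_point (k n)" for n
  define g where "g n = potential (k n)" for n
  note defs = F_def[symmetric] T_def[symmetric] Ti_def[symmetric] p_def[symmetric] g_def[symmetric]
  note KD = castle_forD[OF P, unfolded defs]
  note meas = castle_for_measurable[OF P, unfolded defs] KD(4,5)
  note [measurable] = meas(3-7)
  have "decseq m" 
    by (intro decseq_SucI) (simp add: m_def extends_base_mass[OF ext])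
  then obtain l where l: "m \<longlonglongrightarrow> l" "\<And>n. l \<le> m n"
    using decseq_convergent[of m 0] base_mass_nonneg by (auto simp: m_def)
  have l2: "(\<lambda>n. 2 * m n) \<longlonglongrightarrow> 2 * l"
    by (intro tendsto_intros l)
  have stepT: "measure M {x \<in> space M. T n x \<noteq> T (Suc n) x} \<le> 2 * m n - 2 * m (Suc n)"
    and stepTi: "measure M {x \<in> space M. Ti n x \<noteq> Ti (Suc n) x} \<le> 2 * m n - 2 * m (Suc n)"
    and stepF: "measure M {x \<in> space M. F n x \<noteq> F (Suc n) x} \<le> 2 * m n - 2 * m (Suc n)" for n
    using ext[of n] unfolding extends_def discrepancy_def m_def defs by simp_all
  note limT = eventually_constant_AE[of T, OF meas(3) stepT l2]
  note limTi = eventually_constant_AE[of Ti, OF meas(4) stepTi l2]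
  note limF = eventually_constant_AE[of F, OF meas(5) stepF l2]
  \<comment> \<open>The limit of the transformations is made total as a map of \<open>{0..1}\<close> to itself.\<close>
  define clip where "clip t = (if t \<in> {0..1} then t else 0)" for t :: real
  define T\<^sub>\<omega> where "T\<^sub>\<omega> x = clip (lim (\<lambda>n. T n x))" for x
  define Ti\<^sub>\<omega> where "Ti\<^sub>\<omega> x = clip (lim (\<lambda>n. Ti n x))" for x
  define F\<^sub>\<omega> where "F\<^sub>\<omega> x = (if x \<in> {0..1} then lim (\<lambda>n. F n x) else 0)" for x
  define g\<^sub>\<omega> where "g\<^sub>\<omega> x = real_limsup (\<lambda>n. g n x)" for x
  \<comment> \<open>The value \<open>2\<close> is outside the interval and marks points without a base point.\<close>
  define p\<^sub>\<omega> where "p\<^sub>\<omega> x = (if \<exists>N. \<forall>n\<ge>N. p n x = lim (\<lambda>n. p n x) then lim (\<lambda>n. p n x) else 2)" for x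
  define L where "L = \<lparr>shift = T\<^sub>\<omega>, shift_inv = Ti\<^sub>\<omega>, base_sum = F\<^sub>\<omega>, base_point = p\<^sub>\<omega>, potential = g\<^sub>\<omega>\<rparr>"
  have clip_meas [measurable]: "clip \<in> borel_measurable borel" unfolding clip_def by measurable
  have T_meas: "T\<^sub>\<omega> \<in> M \<rightarrow>\<^sub>M M" and Ti_meas: "Ti\<^sub>\<omega> \<in> M \<rightarrow>\<^sub>M M"
    unfolding measurable_M_iff T\<^sub>\<omega>_def Ti\<^sub>\<omega>_def by (auto simp: clip_def)
  have F_meas: "F\<^sub>\<omega> \<in> borel_measurable borel"
  proof -
    have [measurable]: "F n \<in> borel_measurable borel" for n by (rule KD(2))
    show ?thesis unfolding F\<^sub>\<omega>_def by measurable
  qed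
  have g_meas: "g\<^sub>\<omega> \<in> borel_measurable M" unfolding g\<^sub>\<omega>_def by measurable
  have p_meas: "p\<^sub>\<omega> \<in> borel_measurable M" unfolding p\<^sub>\<omega>_def by measurable
  have range: "T n x \<in> {0..1}" "Ti n x \<in> {0..1}" if "x \<in> {0..1}" for n x
    using meas(1,2) that unfolding measurable_M_iff by blast+
  have T_lim: "AE x in M. lim (\<lambda>n. T n x) = T\<^sub>\<omega> x"
    using limT(1) AE_space
  proof eventually_elim
    case (elim x)
    then obtain n where "T n x = lim (\<lambda>n. T n x)" using eventually_happens'[OF sequentially_bot elim(1)] by blast
    then show ?case using range(1)[of x n] elim(2) by (simp add: T\<^sub>\<omega>_def clip_def space_eq)
  qed
  have Ti_lim: "AE x in M. lim (\<lambda>n. Ti n x) = Ti\<^sub>\<omega> x"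
    using limTi(1) AE_space
  proof eventually_elim
    case (elim x)
    then obtain n where "Ti n x = lim (\<lambda>n. Ti n x)" using eventually_happens'[OF sequentially_bot elim(1)] by blast
    then show ?case using range(2)[of x n] elim(2) by (simp add: Ti\<^sub>\<omega>_def clip_def space_eq)
  qed
  have F_lim: "AE x in M. lim (\<lambda>n. F n x) = F\<^sub>\<omega> x"
    using AE_space by eventually_elim (simp add: F\<^sub>\<omega>_def space_eq)
  have T_ev: "AE x in M. eventually (\<lambda>n. T n x = T\<^sub>\<omega> x) sequentially"
    using limT(1) T_lim by eventually_elim simp
  have Ti_ev: "AE x in M. eventually (\<lambda>n. Ti n x = Ti\<^sub>\<omega> x) sequentially"
    using limTi(1) Ti_lim by eventually_elim simp
  have F_ev: "AE x in M. eventually (\<lambda>n. F n x = F\<^sub>\<omega> x) sequentially"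
    using limF(1) F_lim by eventually_elim simp
  have dist: "discrepancy (h n) h' \<le> 2 * m n - 2 * l"
    if "\<And>n. h n \<in> borel_measurable M" 
      "measure M {x \<in> space M. h n x \<noteq> lim (\<lambda>n. h n x)} \<le> 2 * m n - 2 * l"
      "AE x in M. lim (\<lambda>n. h n x) = h' x" for h :: "nat \<Rightarrow> real \<Rightarrow> real" and h' n
  proof -
    note [measurable] = that(1)
    have "discrepancy (h n) h' \<le> measure M {x \<in> space M. h n x \<noteq> lim (\<lambda>n. h n x)}"
      unfolding discrepancy_def
    proof (rule finite_measure_mono_AE)
      show "AE x in M. x \<in> {x \<in> space M. h n x \<noteq> h' x} \<longrightarrow> x \<in> {x \<in> space M. h n x \<noteq> lim (\<lambda>n. h n x)}"
        using that(3) by eventually_elim simp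
    qed measurable
    then show ?thesis using that(2) by simp
  qed
  have distT: "discrepancy (T n) T\<^sub>\<omega> \<le> 2 * m n - 2 * l" for n
    by (rule dist[OF meas(3) limT(2) T_lim])
  have distTi: "discrepancy (Ti n) Ti\<^sub>\<omega> \<le> 2 * m n - 2 * l" for n
    by (rule dist[OF meas(4) limTi(2) Ti_lim])
  have distF: "discrepancy (F n) F\<^sub>\<omega> \<le> 2 * m n - 2 * l" for n
    by (rule dist[OF meas(5) limF(2) F_lim])
  have zero_meas: "(\<lambda>_. 0) \<in> borel_measurable M" by simp
  have "base_mass L \<le> m n + (2 * m n - 2 * l)" for n
  proof -
    have "base_mass L = discrepancy F\<^sub>\<omega> (\<lambda>_. 0)" "m n = discrepancy (F n) (\<lambda>_. 0)"
      by (simp_all add: base_mass_def L_def discrepancy_def m_def F_def)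
    moreover have "discrepancy F\<^sub>\<omega> (F n) = discrepancy (F n) F\<^sub>\<omega>"
      unfolding discrepancy_def by (rule arg_cong[where f = "measure M"]) auto
    moreover note discrepancy_triangle[OF measurable_from_borel[OF F_meas] meas(5) zero_meas, of n] distF[of n]
    ultimately show ?thesis by simp
  qed
  then have mass: "base_mass L \<le> l"
  proof (intro LIMSEQ_le_const[where X = "\<lambda>n. m n + (2 * m n - 2 * l)"])
    show "(\<lambda>n. m n + (2 * m n - 2 * l)) \<longlonglongrightarrow> l"
      using tendsto_add[OF l(1) tendsto_diff[OF l2 tendsto_const[of "2 * l"]]] by simp
  qed auto
  have extends: "extends (k n) L" for n
    using distT[of n] distTi[of n] distF[of n] mass
    unfolding extends_def L_def castle.select_convs defs m_def[symmetric] by simp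

  have autT: "T n \<in> M \<rightarrow>\<^sub>M M" "distr M M (T n) = M" "Ti n \<in> M \<rightarrow>\<^sub>M M" "distr M M (Ti n) = M"
      "AE x in M. Ti n (T n x) = x" "AE x in M. T n (Ti n x) = x" for n
    using KD(1)[of n] unfolding automorphism_def by - (elim conjE, assumption)+
  have dT: "distr M M T\<^sub>\<omega> = M" by (rule distr_eventually_limit[OF autT(1,2) T_meas T_ev])
  have dTi: "distr M M Ti\<^sub>\<omega> = M" by (rule distr_eventually_limit[OF autT(3,4) Ti_meas Ti_ev])
  have at_T: "AE x in M. R (T\<^sub>\<omega> x)" if "AE x in M. R x" for R
    by (rule AE_preimage[OF T_meas dT that])
  have at_Ti: "AE x in M. R (Ti\<^sub>\<omega> x)" if "AE x in M. R x" for R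
    by (rule AE_preimage[OF Ti_meas dTi that])
  have all: "AE x in M. \<forall>n. Ti n (T n x) = x" "AE x in M. \<forall>n. T n (Ti n x) = x"
      "AE x in M. \<forall>n. f x = g n (T n x) - g n x + F n (T n x)"
      "AE x in M. \<forall>n. p n (T n x) = p n x"
      "AE x in M. \<forall>n. F n x \<noteq> 0 \<longrightarrow> p n x = x \<and> g n x = 0"
      "AE x in M. \<forall>n. \<bar>F n x\<bar> \<le> c \<and> \<bar>g n x\<bar> \<le> c"
    using autT KD(6,7,8,10) by (simp_all only: AE_all_countable simp_thms)
  have inv1: "AE x in M. Ti\<^sub>\<omega> (T\<^sub>\<omega> x) = x"
    using all(1) T_ev at_T[OF Ti_ev]
  proof eventually_elim
    case (elim x)
    from eventually_happens'[OF sequentially_bot eventually_conj[OF elim(2,3)]]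
    obtain n where "T n x = T\<^sub>\<omega> x" "Ti n (T\<^sub>\<omega> x) = Ti\<^sub>\<omega> (T\<^sub>\<omega> x)" by blast
    then show ?case using elim(1)[rule_format, of n] by simp
  qed
  have inv2: "AE x in M. T\<^sub>\<omega> (Ti\<^sub>\<omega> x) = x"
    using all(2) Ti_ev at_Ti[OF T_ev]
  proof eventually_elim
    case (elim x)
    from eventually_happens'[OF sequentially_bot eventually_conj[OF elim(2,3)]]
    obtain n where "Ti n x = Ti\<^sub>\<omega> x" "T n (Ti\<^sub>\<omega> x) = T\<^sub>\<omega> (Ti\<^sub>\<omega> x)" by blast
    then show ?case using elim(1)[rule_format, of n] by simp
  qed
  have aut: "automorphism M T\<^sub>\<omega> Ti\<^sub>\<omega>"
    unfolding automorphism_def using T_meas Ti_meas dT dTi inv1 inv2 by (intro conjI)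
  have cohom: "AE x in M. f x = g\<^sub>\<omega> (T\<^sub>\<omega> x) - g\<^sub>\<omega> x + F\<^sub>\<omega> (T\<^sub>\<omega> x)"
    using all(3,6) at_T[OF all(6)] T_ev at_T[OF F_ev]
  proof eventually_elim
    case (elim x)
    have "eventually (\<lambda>n. g n (T\<^sub>\<omega> x) = g n x + (f x - F\<^sub>\<omega> (T\<^sub>\<omega> x))) sequentially"
      using elim(4,5)
    proof eventually_elim
      case (elim n)
      then show ?case using \<open>\<forall>n. f x = _ n\<close>[rule_format, of n] by simp
    qed
    then have "g\<^sub>\<omega> (T\<^sub>\<omega> x) = g\<^sub>\<omega> x + (f x - F\<^sub>\<omega> (T\<^sub>\<omega> x))"
      unfolding g\<^sub>\<omega>_def using elim(2,3) by (intro real_limsup_add[of _ c]) auto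
    then show ?case by simp
  qed
  have p_lim: "p\<^sub>\<omega> x = y" if "eventually (\<lambda>n. p n x = y) sequentially" for x y
  proof -
    have "lim (\<lambda>n. p n x) = y" using that by (intro limI tendsto_eventually)
    then show ?thesis using that by (auto simp: p\<^sub>\<omega>_def eventually_sequentially)
  qed
  have p_ev: "eventually (\<lambda>n. p n x = p\<^sub>\<omega> x) sequentially" if "p\<^sub>\<omega> x \<in> {0..1}" for x
    using that by (auto simp: p\<^sub>\<omega>_def eventually_sequentially split: if_splits)
  have p_eq: "p\<^sub>\<omega> x = p\<^sub>\<omega> y" if ev: "eventually (\<lambda>n. p n x = p n y) sequentially" for x y
  proof (cases "\<exists>z. eventually (\<lambda>n. p n y = z) sequentially")
    case True
    then obtain z where z: "eventually (\<lambda>n. p n y = z) sequentially" by blast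
    have "eventually (\<lambda>n. p n x = z) sequentially" using ev z by eventually_elim simp
    then show ?thesis using p_lim z by metis
  next
    case False
    have dead: "p\<^sub>\<omega> u = 2" if "\<not> (\<exists>z. eventually (\<lambda>n. p n u = z) sequentially)" for u
    proof -
      have "\<not> (\<exists>N. \<forall>n\<ge>N. p n u = lim (\<lambda>n. p n u))"
        using that unfolding eventually_sequentially by blast
      then show ?thesis unfolding p\<^sub>\<omega>_def by (rule if_not_P)
    qed
    have "\<not> (\<exists>z. eventually (\<lambda>n. p n x = z) sequentially)"
    proof
      assume "\<exists>z. eventually (\<lambda>n. p n x = z) sequentially"
      then obtain z where "eventually (\<lambda>n. p n x = z) sequentially" by blast
      then have "eventually (\<lambda>n. p n y = z) sequentially" using ev by eventually_elim simp
      then show False using False by blast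
    qed
    then show ?thesis using dead False by simp
  qed
  have inv: "AE x in M. p\<^sub>\<omega> (T\<^sub>\<omega> x) = p\<^sub>\<omega> x"
    using all(4) T_ev
  proof eventually_elim
    case (elim x)
    have ev: "eventually (\<lambda>n. p n (T\<^sub>\<omega> x) = p n x) sequentially"
      using elim(2)
    proof eventually_elim
      case (elim n)
      then show ?case using \<open>\<forall>n. p n (T n x) = p n x\<close>[rule_format, of n] by simp
    qed
    then show ?case by (rule p_eq)
  qed
  have base: "AE x in M. F\<^sub>\<omega> x \<noteq> 0 \<longrightarrow> p\<^sub>\<omega> x = x \<and> g\<^sub>\<omega> x = 0"
    using all(5,6) F_ev
  proof (eventually_elim, intro impI)
    fix x assume x: "\<forall>n. F n x \<noteq> 0 \<longrightarrow> p n x = x \<and> g n x = 0" "\<forall>n. \<bar>F n x\<bar> \<le> c \<and> \<bar>g n x\<bar> \<le> c"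
      "eventually (\<lambda>n. F n x = F\<^sub>\<omega> x) sequentially" "F\<^sub>\<omega> x \<noteq> 0"
    have ev: "eventually (\<lambda>n. p n x = x \<and> g n x = 0) sequentially"
      using x(3) by eventually_elim (use x(1,4) in auto)
    have "p\<^sub>\<omega> x = x" using ev by (intro p_lim) (auto elim: eventually_mono)
    moreover have "g\<^sub>\<omega> x \<le> 0" unfolding g\<^sub>\<omega>_def using x(2) ev
      by (intro real_limsup_le[of _ c]) (auto elim: eventually_mono)
    moreover have "0 \<le> g\<^sub>\<omega> x" unfolding g\<^sub>\<omega>_def using x(2) ev
      by (intro real_limsup_ge[of _ c]) (auto elim: eventually_mono)
    ultimately show "p\<^sub>\<omega> x = x \<and> g\<^sub>\<omega> x = 0" by simp
  qed
  have nonsing: "\<forall>R. (AE x in M. R x) \<longrightarrow> (AE x in M. p\<^sub>\<omega> x \<in> {0..1} \<longrightarrow> R (p\<^sub>\<omega> x))"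
  proof (intro allI impI)
    fix R assume R: "AE x in M. R x"
    have "AE x in M. p n x \<in> {0..1} \<longrightarrow> R (p n x)" for n
      by (rule KD(9)[of n, THEN spec, of R, THEN mp, OF R])
    then have "AE x in M. \<forall>n. p n x \<in> {0..1} \<longrightarrow> R (p n x)"
      by (simp only: AE_all_countable simp_thms)
    then show "AE x in M. p\<^sub>\<omega> x \<in> {0..1} \<longrightarrow> R (p\<^sub>\<omega> x)"
    proof eventually_elim
      case (elim x)
      show ?case
      proof
        assume p: "p\<^sub>\<omega> x \<in> {0..1}"
        from eventually_happens'[OF sequentially_bot p_ev[OF p]] obtain n where "p n x = p\<^sub>\<omega> x" by blast
        then show "R (p\<^sub>\<omega> x)" using elim[rule_format, of n] p by simp
      qed
    qed
  qed
  have bd: "AE x in M. \<bar>F\<^sub>\<omega> x\<bar> \<le> c \<and> \<bar>g\<^sub>\<omega> x\<bar> \<le> c"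
    using all(6) F_ev
  proof eventually_elim
    case (elim x)
    from eventually_happens'[OF sequentially_bot elim(2)] obtain n where "F n x = F\<^sub>\<omega> x" by blast
    then have "\<bar>F\<^sub>\<omega> x\<bar> \<le> c" using elim(1)[rule_format, of n] by simp
    moreover have "g\<^sub>\<omega> x \<le> c" unfolding g\<^sub>\<omega>_def using elim(1)
      by (intro real_limsup_le[of _ c]) (auto simp: abs_le_iff)
    moreover have "- c \<le> g\<^sub>\<omega> x" unfolding g\<^sub>\<omega>_def using elim(1)
      by (intro real_limsup_ge[of _ c] always_eventually) (auto simp: abs_le_iff minus_le_iff)
    ultimately show ?case by auto
  qed
  have F_ev_p: "AE x in M. p\<^sub>\<omega> x \<in> {0..1} \<longrightarrow> eventually (\<lambda>n. F n (p\<^sub>\<omega> x) = F\<^sub>\<omega> (p\<^sub>\<omega> x)) sequentially"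
    by (rule nonsing[THEN spec, of "\<lambda>x. eventually (\<lambda>n. F n x = F\<^sub>\<omega> x) sequentially", THEN mp, OF F_ev])
  have all_win: "AE x in M. \<forall>n. AE y in M.
      (F n (p n x) > 0 \<and> F n y < 0 \<longrightarrow> - c - F n y \<le> g n x) \<and>
      (F n (p n x) < 0 \<and> F n y > 0 \<longrightarrow> g n x \<le> c - F n y)"
    using KD(11) by (simp only: AE_all_countable simp_thms)
  have win: "AE x in M. AE y in M.
      (F\<^sub>\<omega> (p\<^sub>\<omega> x) > 0 \<and> F\<^sub>\<omega> y < 0 \<longrightarrow> - c - F\<^sub>\<omega> y \<le> g\<^sub>\<omega> x) \<and>
      (F\<^sub>\<omega> (p\<^sub>\<omega> x) < 0 \<and> F\<^sub>\<omega> y > 0 \<longrightarrow> g\<^sub>\<omega> x \<le> c - F\<^sub>\<omega> y)"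
    using all_win all(6) F_ev_p
  proof eventually_elim
    case (elim x)
    have b: "\<And>n. \<bar>g n x\<bar> \<le> c" using elim(2) by blast
    have "AE y in M. \<forall>n. (F n (p n x) > 0 \<and> F n y < 0 \<longrightarrow> - c - F n y \<le> g n x) \<and>
      (F n (p n x) < 0 \<and> F n y > 0 \<longrightarrow> g n x \<le> c - F n y)"
      using elim(1) by (simp only: AE_all_countable simp_thms)
    then show ?case
      using F_ev
    proof eventually_elim
      case (elim y)
      show ?case
      proof (cases "F\<^sub>\<omega> (p\<^sub>\<omega> x) = 0")
        case False
        then have p: "p\<^sub>\<omega> x \<in> {0..1}" by (auto simp: F\<^sub>\<omega>_def split: if_splits)
        have ev: "eventually (\<lambda>n. F n (p n x) = F\<^sub>\<omega> (p\<^sub>\<omega> x) \<and> F n y = F\<^sub>\<omega> y) sequentially"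
          using p_ev[OF p] \<open>p\<^sub>\<omega> x \<in> {0..1} \<longrightarrow> _\<close>[rule_format, OF p] elim(2)
          by eventually_elim simp
        have "- c - F\<^sub>\<omega> y \<le> g\<^sub>\<omega> x" if "F\<^sub>\<omega> (p\<^sub>\<omega> x) > 0" "F\<^sub>\<omega> y < 0"
          unfolding g\<^sub>\<omega>_def
        proof (rule real_limsup_ge[of _ c, OF b])
          show "eventually (\<lambda>n. - c - F\<^sub>\<omega> y \<le> g n x) sequentially"
            using ev by eventually_elim (use that elim(1) in metis)
        qed
        moreover have "g\<^sub>\<omega> x \<le> c - F\<^sub>\<omega> y" if "F\<^sub>\<omega> (p\<^sub>\<omega> x) < 0" "F\<^sub>\<omega> y > 0"
          unfolding g\<^sub>\<omega>_def
        proof (rule real_limsup_le[of _ c, OF b])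
          show "eventually (\<lambda>n. g n x \<le> c - F\<^sub>\<omega> y) sequentially"
            using ev by eventually_elim (use that elim(1) in metis)
        qed
        ultimately show ?thesis by blast
      qed simp
    qed
  qed
  have off: "\<forall>x. x \<notin> {0..1} \<longrightarrow> F\<^sub>\<omega> x = 0" by (simp add: F\<^sub>\<omega>_def)
  note facts = aut F_meas off p_meas g_meas cohom inv base nonsing bd win
  have "castle_for f c L"
    by (rule castle_forI; unfold L_def castle.select_convs) (fact facts)+
  with extends show ?thesis by blast
qed

section \<open>Exhausting the base\<close>

text \<open>
  This is the essential supremum of \<open>h\<close> as a real number.
\<close>
lemma tight_upper_bound:
  fixes h :: "real \<Rightarrow> real"
  assumes h [measurable]: "h \<in> borel_measurable M" and bd: "AE x in M. \<bar>h x\<bar> \<le> c"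
  obtains a where "AE x in M. h x \<le> a" "\<And>z. z < a \<Longrightarrow> 0 < measure M {x \<in> space M. z < h x}"
proof -
  define S where "S = {z. AE x in M. h x \<le> z}"
  have "c \<in> S" using bd unfolding S_def by (auto elim: eventually_mono)
  have bdd: "bdd_below S"
  proof (rule bdd_belowI[of _ "- c"])
    fix z assume "z \<in> S"
    then have "AE x in M. h x \<le> z" by (simp add: S_def)
    then have "AE x in M. - c \<le> z" using bd by eventually_elim auto
    then show "- c \<le> z" by simp
  qed
  define a where "a = Inf S"
  have "AE x in M. h x \<le> a + 1 / real (Suc n)" for n
  proof -
    have "Inf S < a + 1 / real (Suc n)" by (simp add: a_def)
    then obtain z where "z \<in> S" "z < a + 1 / real (Suc n)"
      using cInf_lessD \<open>c \<in> S\<close> by blast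
    then show ?thesis unfolding S_def by (auto elim: eventually_mono)
  qed
  then have "AE x in M. \<forall>n. h x \<le> a + 1 / real (Suc n)" by (simp only: AE_all_countable simp_thms)
  then have "AE x in M. h x \<le> a"
  proof eventually_elim
    case (elim x)
    show ?case
    proof (rule ccontr)
      assume "\<not> h x \<le> a"
      then obtain n where "1 / real (Suc n) < h x - a" using nat_approx_posE[of "h x - a"] by auto
      then show False using elim[rule_format, of n] by simp
    qed
  qed
  moreover have "0 < measure M {x \<in> space M. z < h x}" if z: "z < a" for z
  proof (rule ccontr)
    assume "\<not> 0 < measure M {x \<in> space M. z < h x}"
    then have "measure M {x \<in> space M. z < h x} = 0" using measure_nonneg[of M] by (simp add: order_less_le)
    then have "AE x in M. \<not> z < h x" by (subst (asm) prob_eq_0) auto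
    then have "z \<in> S" unfolding S_def by (auto elim!: eventually_mono)
    then have "a \<le> z" unfolding a_def by (rule cInf_lower[OF _ bdd])
    with z show False by simp
  qed
  ultimately show ?thesis using that by blast
qed

text \<open>
  The equivalence is needed besides the inequality, since it locates \<open>u\<close> relative to given bounds
  even if the distribution of \<open>h\<close> has atoms or gaps.
\<close>
lemma quantile:
  fixes h :: "real \<Rightarrow> real"
  assumes h [measurable]: "h \<in> borel_measurable M" and m: "0 < m" "m < 1"
  obtains u where "measure M {x \<in> space M. h x < u} \<le> m" "\<And>v. m \<le> measure M {x \<in> space M. h x \<le> v} \<longleftrightarrow> u \<le> v"
proof -
  interpret D: cdf_distribution "distr M borel h"
    unfolding cdf_distribution_def by (rule real_distribution_distr) simp
  have le: "D.C v = measure M {x \<in> space M. h x \<le> v}" for v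
    by (simp add: cdf_def measure_distr vimage_def Int_def conj_commute)
  have less: "measure (distr M borel h) {..<v} = measure M {x \<in> space M. h x < v}" for v
    by (simp add: measure_distr vimage_def Int_def conj_commute)
  define u where "u = D.I m"
  have iff: "m \<le> D.C v \<longleftrightarrow> u \<le> v" for v
    unfolding u_def using D.pseudoinverse'[rule_format, of m v] m by simp
  have "eventually (\<lambda>v. D.C v \<le> m) (at_left u)"
    unfolding eventually_at_filter
  proof (rule always_eventually, intro allI impI)
    fix v assume "v \<in> {..<u}"
    then show "D.C v \<le> m" using iff[of v] by simp
  qed
  then have "measure (distr M borel h) {..<u} \<le> m"
    by (rule tendsto_upperbound[OF D.cdf_at_left]) simp
  then show ?thesis using that iff unfolding le less by blast
qed

text \<open>
  Integrate the equation for \<open>f\<close>: the two terms with the potential cancel by invariance.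
\<close>
lemma base_sum_integral:
  assumes K: "castle_for f c K" and f: "f \<in> borel_measurable M" "(\<integral>x. f x \<partial>M) = 0"
  shows "integrable M (base_sum K)" "(\<integral>x. base_sum K x \<partial>M) = 0"
proof -
  note KD = castle_forD[OF K] and meas = castle_for_measurable[OF K]
  have d: "distr M M (shift K) = M" using KD(1) unfolding automorphism_def by (elim conjE)
  note [measurable] = meas(1,5) KD(5)
  have bd: "AE x in M. norm (base_sum K x) \<le> c" "AE x in M. norm (potential K x) \<le> c"
    using KD(10) by (eventually_elim, simp)+
  have int: "integrable M (base_sum K)" "integrable M (potential K)"
    by (rule integrable_const_bound[OF bd(1)], measurable) (rule integrable_const_bound[OF bd(2)], measurable)
  have shift: "integrable M (\<lambda>x. h (shift K x))" "(\<integral>x. h (shift K x) \<partial>M) = (\<integral>x. h x \<partial>M)"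
    if "integrable M h" for h :: "real \<Rightarrow> real"
  proof -
    have "integrable (distr M M (shift K)) h" unfolding d by (rule that)
    then show "integrable M (\<lambda>x. h (shift K x))" by (rule integrable_distr[OF meas(1)])
    have "(\<integral>x. h x \<partial>distr M M (shift K)) = (\<integral>x. h (shift K x) \<partial>M)"
      using that by (intro integral_distr meas(1)) auto
    then show "(\<integral>x. h (shift K x) \<partial>M) = (\<integral>x. h x \<partial>M)" unfolding d by simp
  qed
  show "integrable M (base_sum K)" by (rule int)
  have "(\<integral>x. f x \<partial>M) = (\<integral>x. potential K (shift K x) - potential K x + base_sum K (shift K x) \<partial>M)"
    using KD(6) f(1) by (intro integral_cong_AE) auto
  also have "\<dots> = (\<integral>x. base_sum K x \<partial>M)"
    using shift[OF int(1)] shift[OF int(2)] int by simp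
  finally show "(\<integral>x. base_sum K x \<partial>M) = 0" using f(2) by simp
qed

lemma upper_bound_pos:
  fixes h :: "real \<Rightarrow> real"
  assumes h: "integrable M h" "(\<integral>x. h x \<partial>M) = 0" and le: "AE x in M. h x \<le> a"
    and nz: "measure M {x \<in> space M. h x \<noteq> 0} \<noteq> 0"
  shows "0 < a"
proof (rule ccontr)
  assume "\<not> 0 < a"
  then have "AE x in M. 0 \<le> - h x" using le by (auto elim: eventually_mono)
  moreover have "(\<integral>x. - h x \<partial>M) = 0" "integrable M (\<lambda>x. - h x)" using h by simp_all
  ultimately have "AE x in M. - h x = 0" using integral_nonneg_eq_0_iff_AE by blast
  then have "AE x in M. x \<notin> {x \<in> space M. h x \<noteq> 0}" by (auto elim: eventually_mono)
  then have "measure M {x \<in> space M. h x \<noteq> 0} = 0"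
    using h(1) by (subst prob_eq_0) auto
  with nz show False by simp
qed

text \<open>
  If \<open>a < b\<close>, every tower with sum below \<open>-a\<close> dominates every positive tower and the bounds are kept. If
  \<open>a = b\<close>, all sums above \<open>a / 2\<close> have to disappear at once. They are matched with the lowest sums,
  because a combined sum that is still positive then comes from a tower with sum at least \<open>t\<close> at the
  foot, where \<open>-t\<close> is a lower bound for the negative sums that remain.
\<close>
lemma progress_ordered:
  assumes K: "castle_for f c K" and mean: "integrable M (base_sum K)" "(\<integral>x. base_sum K x \<partial>M) = 0"
    and nz: "base_mass K \<noteq> 0"
    and a: "AE x in M. base_sum K x \<le> a" "\<And>z. z < a \<Longrightarrow> 0 < measure M {x \<in> space M. z < base_sum K x}"
    and b: "AE x in M. - base_sum K x \<le> b" "\<And>z. z < b \<Longrightarrow> 0 < measure M {x \<in> space M. z < - base_sum K x}"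
    and ord: "a < b \<or> a = b \<and> measure M {x \<in> space M. a / 2 < base_sum K x} \<le> measure M {x \<in> space M. a / 2 < - base_sum K x}"
  shows "\<exists>L. castle_for f c L \<and> extends K L \<and> base_mass L < base_mass K"
proof -
  define F where "F = base_sum K"
  define p where "p = base_point K"
  define g where "g = potential K"
  note KD = castle_forD[OF K, folded F_def p_def g_def]
  note a = a[folded F_def] and b = b[folded F_def] and mean = mean[folded F_def]
  have F [measurable]: "F \<in> borel_measurable M" unfolding F_def by (rule castle_for_measurable[OF K])
  have nzF: "measure M {x \<in> space M. F x \<noteq> 0} \<noteq> 0" using nz by (simp add: base_mass_def F_def)
  have "0 < a" by (rule upper_bound_pos[OF mean a(1) nzF])
  have "0 < b" by (rule upper_bound_pos[of "\<lambda>x. - F x"]) (use mean b(1) nzF in simp_all)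
  have bounds: "AE x in M. - b \<le> F x \<and> F x \<le> a"
    using a(1) b(1) by eventually_elim simp
  \<comment> \<open>As \<open>a\<close> and \<open>b\<close> are optimal, sums arbitrarily close to them occur with positive probability.\<close>
  have window: "AE x in M. (F (p x) > 0 \<longrightarrow> - c + b \<le> g x) \<and> (F (p x) < 0 \<longrightarrow> g x \<le> c - a)"
    using KD(11)
  proof eventually_elim
    case (elim x)
    show ?case
    proof (intro conjI impI; rule ccontr)
      assume *: "F (p x) > 0" "\<not> - c + b \<le> g x"
      define z where "z = max 0 (g x + c)"
      have "z < b" using * \<open>0 < b\<close> by (simp add: z_def)
      have "AE y in M. \<not> z < - F y"
        using elim by eventually_elim (use * in \<open>auto simp: z_def\<close>)
      then have "measure M {y \<in> space M. z < - F y} = 0" by (subst prob_eq_0) (auto elim: eventually_mono)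
      then show False using b(2)[OF \<open>z < b\<close>] by simp
    next
      assume *: "F (p x) < 0" "\<not> g x \<le> c - a"
      define z where "z = max 0 (c - g x)"
      have "z < a" using * \<open>0 < a\<close> by (simp add: z_def)
      have "AE y in M. \<not> z < F y"
        using elim by eventually_elim (use * in \<open>auto simp: z_def\<close>)
      then have "measure M {y \<in> space M. z < F y} = 0" by (subst prob_eq_0) (auto elim: eventually_mono)
      then show False using a(2)[OF \<open>z < a\<close>] by simp
    qed
  qed
  note stack = stack_towers[OF K, folded F_def p_def g_def, OF bounds window]
  have at_s: "AE x in M. P (s x)" if "automorphism M s s" "AE x in M. P x" for s P
    using that(1) unfolding automorphism_def by (elim conjE) (rule AE_preimage[OF _ _ that(2)])
  have ss: "AE x in M. s (s x) = x" if "automorphism M s s" for s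
    using that unfolding automorphism_def by (elim conjE)
  show ?thesis
  proof (cases "a < b")
    case True
    define Y where "Y = {x \<in> space M. a < - F x}"
    define Q where "Q = {x \<in> space M. 0 < F x}"
    have YQ: "Y \<in> sets M" "Q \<in> sets M" unfolding Y_def Q_def by measurable
    define m where "m = min (measure M Y) (measure M Q)"
    have "0 < m" using b(2)[OF True] a(2)[OF \<open>0 < a\<close>] by (simp add: m_def Y_def Q_def)
    obtain B where B: "B \<in> sets M" "B \<subseteq> Y" "measure M B = m"
      using between[of "{}" Y m] YQ \<open>0 < m\<close> by (auto simp: m_def)
    obtain C where C: "C \<in> sets M" "C \<subseteq> Q" "measure M C = m"
      using between[of "{}" Q m] YQ \<open>0 < m\<close> by (auto simp: m_def)
    have disj: "B \<inter> C = {}" using B(2) C(2) \<open>0 < a\<close> by (force simp: Y_def Q_def)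
    obtain s where s: "s \<in> borel_measurable borel" "automorphism M s s"
      and move: "AE x in M. (x \<in> B \<longrightarrow> s x \<in> C) \<and> (x \<in> C \<longrightarrow> s x \<in> B)" "\<And>x. x \<notin> B \<union> C \<Longrightarrow> s x = x"
      using swap[OF B(1) C(1) disj] B(3) C(3) by auto
    have "AE x in M. x \<in> B \<longrightarrow> F x * F (s x) < 0 \<and> \<bar>F (s x)\<bar> \<le> \<bar>F x\<bar> \<and>
      (F x > 0 \<longrightarrow> b \<le> F x) \<and> (F x < 0 \<longrightarrow> a \<le> - F x)"
      using move(1) at_s[OF s(2) a(1)]
    proof eventually_elim
      case (elim x)
      show ?case
      proof
        assume "x \<in> B"
        then have "a < - F x" "0 < F (s x)" using elim B(2) C(2) by (auto simp: Y_def Q_def)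
        then show "F x * F (s x) < 0 \<and> \<bar>F (s x)\<bar> \<le> \<bar>F x\<bar> \<and> (F x > 0 \<longrightarrow> b \<le> F x) \<and> (F x < 0 \<longrightarrow> a \<le> - F x)"
          using elim(2) \<open>0 < a\<close> by (auto simp: mult_less_0_iff)
      qed
    qed
    moreover have "AE x in M. (x \<in> B \<longrightarrow> - b \<le> F x + F (s x) \<and> F x + F (s x) \<le> a) \<and>
      (x \<notin> B \<union> C \<longrightarrow> - b \<le> F x \<and> F x \<le> a)"
      using move(1) at_s[OF s(2) a(1)] bounds
    proof eventually_elim
      case (elim x)
      have "a < - F x \<and> 0 < F (s x)" if "x \<in> B" using that elim B(2) C(2) by (auto simp: Y_def Q_def)
      then show ?case using elim \<open>0 < a\<close> by auto
    qed
    ultimately obtain L where "castle_for f c L" "extends K L" "base_mass L + measure M C \<le> base_mass K"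
      using stack[OF s B(1) C(1) disj move, of a b] \<open>0 < a\<close> \<open>0 < b\<close> by auto
    then show ?thesis using C(3) \<open>0 < m\<close> by (intro exI[of _ L]) simp
  next
    case False
    then have ab: "b = a" and P_le: "measure M {x \<in> space M. a / 2 < F x} \<le> measure M {x \<in> space M. a / 2 < - F x}"
      using ord by (auto simp: F_def)
    define P where "P = {x \<in> space M. a / 2 < F x}"
    define m where "m = measure M P"
    have [measurable]: "P \<in> sets M" unfolding P_def by measurable
    have "0 < m" using a(2)[of "a / 2"] \<open>0 < a\<close> by (simp add: m_def P_def)
    have "m < 1"
    proof -
      have "2 * m \<le> measure M P + measure M {x \<in> space M. a / 2 < - F x}"
        using P_le by (simp add: m_def P_def)
      also have "\<dots> = measure M (P \<union> {x \<in> space M. a / 2 < - F x})"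
        using \<open>0 < a\<close> by (subst finite_measure_Union) (auto simp: P_def)
      also have "\<dots> \<le> 1" by simp
      finally show ?thesis using \<open>0 < m\<close> by simp
    qed
    obtain u where u: "measure M {x \<in> space M. F x < u} \<le> m" "\<And>v. m \<le> measure M {x \<in> space M. F x \<le> v} \<longleftrightarrow> u \<le> v"
      using quantile[OF F \<open>0 < m\<close> \<open>m < 1\<close>] by blast
    define t where "t = - u"
    have "a / 2 \<le> t"
    proof -
      have "m \<le> measure M {x \<in> space M. a / 2 < - F x}" using P_le by (simp add: m_def P_def)
      also have "\<dots> \<le> measure M {x \<in> space M. F x \<le> - (a / 2)}" by (intro finite_measure_mono) auto
      finally show ?thesis using u(2)[of "- (a / 2)"] by (simp add: t_def)
    qed
    have "t \<le> a"
    proof (rule ccontr)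
      assume "\<not> t \<le> a"
      then have "AE x in M. \<not> F x \<le> u" using bounds by (auto elim!: eventually_mono simp: t_def ab)
      then have "measure M {x \<in> space M. F x \<le> u} = 0" by (subst prob_eq_0) (auto elim: eventually_mono)
      then show False using u(2)[of u] \<open>0 < m\<close> by simp
    qed
    obtain N where N: "N \<in> sets M" "{x \<in> space M. F x < u} \<subseteq> N" "N \<subseteq> {x \<in> space M. F x \<le> u}" "measure M N = m"
    proof -
      have "{x \<in> space M. F x < u} \<in> sets M" "{x \<in> space M. F x \<le> u} \<in> sets M" by measurable
      moreover have "{x \<in> space M. F x < u} \<subseteq> {x \<in> space M. F x \<le> u}" by auto
      ultimately show ?thesis using between u(1) u(2)[of u] that by blast
    qed
    note [measurable] = N(1)
    have inN: "F x \<le> - t" if "x \<in> N" for x using that N(3) by (auto simp: t_def)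
    have offN: "- t \<le> F x" if "x \<notin> N" "x \<in> space M" for x using that N(2) by (auto simp: t_def not_less)
    have inP: "a / 2 < F x" if "x \<in> P" for x using that by (simp add: P_def)
    have "P \<inter> N = {}" using inN inP \<open>0 < a\<close> \<open>a / 2 \<le> t\<close> by fastforce
    obtain s where s: "s \<in> borel_measurable borel" "automorphism M s s"
      and move: "AE x in M. (x \<in> P \<longrightarrow> s x \<in> N) \<and> (x \<in> N \<longrightarrow> s x \<in> P)" "\<And>x. x \<notin> P \<union> N \<Longrightarrow> s x = x"
      using swap[OF \<open>P \<in> sets M\<close> N(1) \<open>P \<inter> N = {}\<close>] N(4) by (auto simp: m_def)
    have sM [measurable]: "s \<in> M \<rightarrow>\<^sub>M M" "distr M M s = M" using s(2) by (auto simp: automorphism_def)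
    \<comment> \<open>In each matched pair the tower with the dominating sum goes below; \<open>s\<close> exchanges the two choices.\<close>
    define B where "B = {x \<in> P. 0 \<le> F x + F (s x)} \<union> {x \<in> N. F x + F (s x) < 0}"
    define C where "C = {x \<in> P. F x + F (s x) < 0} \<union> {x \<in> N. 0 \<le> F x + F (s x)}"
    have BC: "B \<in> sets M" "C \<in> sets M" unfolding B_def C_def by measurable
    have un: "B \<union> C = P \<union> N" by (auto simp: B_def C_def)
    have disj: "B \<inter> C = {}" using \<open>P \<inter> N = {}\<close> by (auto simp: B_def C_def)
    have move': "AE x in M. (x \<in> B \<longrightarrow> s x \<in> C) \<and> (x \<in> C \<longrightarrow> s x \<in> B)"
      using move(1) ss[OF s(2)]
      by eventually_elim (auto simp: B_def C_def add.commute)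
    have stay: "s x = x" if "x \<notin> B \<union> C" for x using that move(2) un by simp
    have cases_B: "x \<in> B \<Longrightarrow> (x \<in> P \<and> s x \<in> N \<and> 0 \<le> F x + F (s x)) \<or> (x \<in> N \<and> s x \<in> P \<and> F x + F (s x) < 0)"
      if "(x \<in> P \<longrightarrow> s x \<in> N) \<and> (x \<in> N \<longrightarrow> s x \<in> P)" for x
      using that by (auto simp: B_def)
    have "AE x in M. x \<in> B \<longrightarrow> F x * F (s x) < 0 \<and> \<bar>F (s x)\<bar> \<le> \<bar>F x\<bar> \<and>
      (F x > 0 \<longrightarrow> t \<le> F x) \<and> (F x < 0 \<longrightarrow> a / 2 \<le> - F x)"
      using move(1)
    proof eventually_elim
      case (elim x)
      show ?case
      proof
        assume "x \<in> B"
        with cases_B[OF elim] consider "x \<in> P" "s x \<in> N" "0 \<le> F x + F (s x)" | "x \<in> N" "s x \<in> P" "F x + F (s x) < 0"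
          by blast
        then show "F x * F (s x) < 0 \<and> \<bar>F (s x)\<bar> \<le> \<bar>F x\<bar> \<and> (F x > 0 \<longrightarrow> t \<le> F x) \<and> (F x < 0 \<longrightarrow> a / 2 \<le> - F x)"
        proof cases
          case 1
          then show ?thesis using inP[OF 1(1)] inN[OF 1(2)] \<open>0 < a\<close> \<open>a / 2 \<le> t\<close> by (auto simp: mult_less_0_iff)
        next
          case 2
          then show ?thesis using inP[OF 2(2)] inN[OF 2(1)] \<open>0 < a\<close> \<open>a / 2 \<le> t\<close> by (auto simp: mult_less_0_iff)
        qed
      qed
    qed
    moreover have "AE x in M. (x \<in> B \<longrightarrow> - t \<le> F x + F (s x) \<and> F x + F (s x) \<le> a / 2) \<and>
      (x \<notin> B \<union> C \<longrightarrow> - t \<le> F x \<and> F x \<le> a / 2)"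
      using move(1) bounds at_s[OF s(2) bounds] AE_space
    proof eventually_elim
      case (elim x)
      have "- t \<le> F x + F (s x) \<and> F x + F (s x) \<le> a / 2" if "x \<in> B"
        using cases_B[OF elim(1) that]
      proof (elim disjE conjE)
        assume "x \<in> P" "s x \<in> N" "0 \<le> F x + F (s x)"
        then show ?thesis using inN[of "s x"] elim(2) \<open>0 < a\<close> \<open>a / 2 \<le> t\<close> by linarith
      next
        assume "x \<in> N" "s x \<in> P" "F x + F (s x) < 0"
        then show ?thesis using inP[of "s x"] elim(2) \<open>0 < a\<close> \<open>a / 2 \<le> t\<close> ab by linarith
      qed
      moreover have "- t \<le> F x \<and> F x \<le> a / 2" if "x \<notin> B \<union> C"
        using that offN[OF _ elim(4)] elim(4) unfolding un by (auto simp: P_def)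
      ultimately show ?case by blast
    qed
    ultimately obtain L where L: "castle_for f c L" "extends K L" "base_mass L + measure M C \<le> base_mass K"
      using stack[OF s BC disj move' stay, of "a / 2" t] \<open>0 < a\<close> \<open>a / 2 \<le> t\<close> \<open>t \<le> a\<close> ab by auto
    have "0 < measure M C"
    proof -
      have "measure M B \<le> measure M {x \<in> space M. s x \<in> C}"
      proof (rule finite_measure_mono_AE)
        show "AE x in M. x \<in> B \<longrightarrow> x \<in> {x \<in> space M. s x \<in> C}"
          using move' AE_space by eventually_elim simp
      qed (use BC sM in measurable)
      also have "\<dots> = measure M C" by (rule measure_preimage[OF sM BC(2)])
      finally have "measure M B \<le> measure M C" .
      moreover have "measure M (B \<union> C) = measure M B + measure M C"
        using BC disj by (rule finite_measure_Union)
      moreover have "m \<le> measure M (B \<union> C)"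
        unfolding un m_def by (intro finite_measure_mono) auto
      ultimately show ?thesis using \<open>0 < m\<close> by linarith
    qed
    then show ?thesis using L by (intro exI[of _ L]) simp
  qed
qed

text \<open>
  The two signs play symmetric roles, so the bound for the positive sums may be taken as the smaller one.
\<close>
lemma progress:
  assumes K: "castle_for f c K" and f: "f \<in> borel_measurable M" "(\<integral>x. f x \<partial>M) = 0"
    and nz: "base_mass K \<noteq> 0"
  shows "\<exists>L. castle_for f c L \<and> extends K L \<and> base_mass L < base_mass K"
proof -
  have F: "base_sum K \<in> borel_measurable M" by (rule castle_for_measurable[OF K])
  have "AE x in M. \<bar>base_sum K x\<bar> \<le> c" "AE x in M. \<bar>- base_sum K x\<bar> \<le> c"
    using castle_forD(10)[OF K] by (auto elim: eventually_mono)
  note bd = this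
  obtain a where a: "AE x in M. base_sum K x \<le> a"
      "\<And>z. z < a \<Longrightarrow> 0 < measure M {x \<in> space M. z < base_sum K x}"
    using tight_upper_bound[OF F bd(1)] by blast
  obtain b where b: "AE x in M. - base_sum K x \<le> b"
      "\<And>z. z < b \<Longrightarrow> 0 < measure M {x \<in> space M. z < - base_sum K x}"
    using tight_upper_bound[OF borel_measurable_uminus[OF F] bd(2)] by blast
  note mean = base_sum_integral[OF K f]
  define ord where "ord h \<longleftrightarrow> measure M {x \<in> space M. a / 2 < h x} \<le> measure M {x \<in> space M. a / 2 < - h x}"
    for h :: "real \<Rightarrow> real"
  show ?thesis
  proof (cases "a < b \<or> a = b \<and> ord (base_sum K)")
    case True
    then show ?thesis using progress_ordered[OF K mean nz a b] unfolding ord_def by blast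
  next
    case False
    have sel: "base_sum (negate K) = (\<lambda>x. - base_sum K x)" by (simp add: negate_def)
    have "\<exists>L. castle_for (\<lambda>x. - f x) c L \<and> extends (negate K) L \<and> base_mass L < base_mass (negate K)"
    proof (rule progress_ordered[OF castle_for_negate[OF K], of b a])
      show "b < a \<or> b = a \<and> measure M {x \<in> space M. b / 2 < base_sum (negate K) x} \<le>
          measure M {x \<in> space M. b / 2 < - base_sum (negate K) x}"
        using False unfolding ord_def sel by auto
    qed (use mean nz a b in \<open>simp_all add: sel base_mass_negate\<close>)
    then obtain L where L: "castle_for (\<lambda>x. - f x) c L" "extends (negate K) L" "base_mass L < base_mass K"
      by (auto simp: base_mass_negate)
    have "castle_for f c (negate L)" using castle_for_negate[OF L(1)] by simp
    moreover have "extends K (negate L)" using L(2) extends_negate[of K "negate L"] by (simp add: negate_negate)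
    ultimately show ?thesis using L(3) by (intro exI[of _ "negate L"]) (simp add: base_mass_negate)
  qed
qed

theorem bounded_coboundary:
  fixes f :: "real \<Rightarrow> real"
  assumes f: "f \<in> borel_measurable borel" "\<And>x. \<bar>f x\<bar> \<le> c" "\<And>x. x \<notin> {0..1} \<Longrightarrow> f x = 0"
    and mean: "(\<integral>x. f x \<partial>M) = 0"
  obtains T T' g where "automorphism M T T'" "g \<in> borel_measurable M"
    "AE x in M. f x = g (T x) - g x" "AE x in M. \<bar>g x\<bar> \<le> c"
proof -
  define K0 where "K0 = \<lparr>shift = \<lambda>x. x, shift_inv = \<lambda>x. x, base_sum = f, base_point = \<lambda>x. x, potential = \<lambda>_. 0\<rparr>"
  have c: "0 \<le> c" using f(2)[of 0] by simp
  have fM: "f \<in> borel_measurable M" by (rule measurable_from_borel[OF f(1)])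
  have "castle_for f c K0"
  proof (rule castle_forI; unfold K0_def castle.select_convs)
    show "AE x in M. AE y in M. (0 < f x \<and> f y < 0 \<longrightarrow> - c - f y \<le> 0) \<and> (f x < 0 \<and> 0 < f y \<longrightarrow> 0 \<le> c - f y)"
      using f(2) by (intro AE_I2) (auto simp: abs_le_iff minus_le_iff)
    show "(\<lambda>x. x) \<in> borel_measurable M" by (rule measurable_from_borel) simp
  qed (use f c in \<open>auto simp: automorphism_id\<close>)
  obtain K where K: "castle_for f c K"
      and max: "\<And>L. castle_for f c L \<Longrightarrow> extends K L \<Longrightarrow> base_mass L = base_mass K"
  proof (rule maximal_of_chain_closed[of "castle_for f c" K0 base_mass
        "\<lambda>K L. castle_for f c K \<and> castle_for f c L \<and> extends K L"])
    fix k assume "\<And>n. castle_for f c (k n)" "\<And>n. castle_for f c (k n) \<and> castle_for f c (k (Suc n)) \<and> extends (k n) (k (Suc n))"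
    then show "\<exists>L. castle_for f c L \<and> (\<forall>n. castle_for f c (k n) \<and> castle_for f c L \<and> extends (k n) L)"
      using castle_chain_limit[of f c k] by blast
  qed (use \<open>castle_for f c K0\<close> base_mass_nonneg extends_refl extends_base_mass extends_trans in blast)+
  \<comment> \<open>Otherwise a further step would contradict maximality.\<close>
  have "base_mass K = 0"
    using progress[OF K fM mean] max by fastforce
  note KD = castle_forD[OF K]
  have [measurable]: "base_sum K \<in> borel_measurable M" by (rule castle_for_measurable[OF K])
  have T: "shift K \<in> M \<rightarrow>\<^sub>M M" "distr M M (shift K) = M" using KD(1) by (simp_all add: automorphism_def)
  have "AE x in M. x \<notin> {x \<in> space M. base_sum K x \<noteq> 0}"
    using \<open>base_mass K = 0\<close> unfolding base_mass_def by (subst (asm) prob_eq_0) auto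
  then have "AE x in M. base_sum K x = 0" using AE_space by eventually_elim simp
  then have "AE x in M. base_sum K (shift K x) = 0" by (rule AE_preimage[OF T])
  then have "AE x in M. f x = potential K (shift K x) - potential K x"
    using KD(6) by eventually_elim simp
  then show ?thesis
    using KD(1,5,10) by (intro that[of "shift K" "shift_inv K" "potential K"]) auto
qed

end

section \<open>The unit interval\<close>

lemma unit_interval_homogeneous: "homogeneous_interval unit_interval"
proof -
  have meas: "measure unit_interval A = measure lborel A" if "A \<subseteq> {0..1}" for A
    using that by (intro measure_restrict_space) auto
  have sets: "A \<in> sets borel \<and> A \<subseteq> {0..1}" if "A \<in> sets unit_interval" for A
    using that by (auto simp: sets_restrict_space)
  have fin: "emeasure lborel A < \<infinity>" if "A \<subseteq> {0..1}" for A :: "real set"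
  proof -
    have "emeasure lborel A \<le> emeasure lborel {0..1::real}" using that by (intro emeasure_mono) auto
    then show ?thesis by (simp add: le_less_trans)
  qed
  interpret prob_space unit_interval
    by (rule prob_spaceI) (simp add: space_restrict_space emeasure_restrict_space)
  show ?thesis
  proof
    show "sets unit_interval = sets (restrict_space borel {0..1})"
      by (simp add: sets_restrict_space)
  next
    fix B C assume BC: "B \<in> sets unit_interval" "C \<in> sets unit_interval" "B \<inter> C = {}"
      and eq: "measure unit_interval B = measure unit_interval C"
    note B = sets[OF BC(1)] and C = sets[OF BC(2)]
    have "emeasure lborel B = emeasure lborel C"
      using eq B C meas fin[of B] fin[of C] by (simp add: emeasure_eq_ennreal_measure)
    then obtain s where s: "s \<in> borel_measurable borel" "s \<in> unit_interval \<rightarrow>\<^sub>M unit_interval"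
        "distr unit_interval unit_interval s = unit_interval"
        "AE x in unit_interval. s (s x) = x"
        "AE x in unit_interval. (x \<in> B \<longrightarrow> s x \<in> C) \<and> (x \<in> C \<longrightarrow> s x \<in> B)"
        "\<And>x. x \<notin> B \<union> C \<Longrightarrow> s x = x"
      using measurable_swap_of_equal_measure[of B C] B C BC(3) by blast
    then show "\<exists>s \<in> borel_measurable borel. automorphism unit_interval s s \<and>
        (AE x in unit_interval. (x \<in> B \<longrightarrow> s x \<in> C) \<and> (x \<in> C \<longrightarrow> s x \<in> B)) \<and>
        (\<forall>x. x \<notin> B \<union> C \<longrightarrow> s x = x)"
      unfolding automorphism_def by (intro bexI[of _ s] conjI) auto
  next
    fix E G m assume EG: "E \<in> sets unit_interval" "G \<in> sets unit_interval" "E \<subseteq> G"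
      and m: "measure unit_interval E \<le> m" "m \<le> measure unit_interval G"
    obtain H where "H \<in> sets borel" "E \<subseteq> H" "H \<subseteq> G" "measure lborel H = m"
      using intermediate_measure[of E G m] sets[OF EG(1)] sets[OF EG(2)] EG(3) m meas by metis
    then show "\<exists>H \<in> sets unit_interval. E \<subseteq> H \<and> H \<subseteq> G \<and> measure unit_interval H = m"
      using sets[OF EG(2)] meas[of H] by (intro bexI[of _ H]) (auto simp: sets_restrict_space)
  qed
qed

theorem theorem0p1:
  fixes f :: "real \<Rightarrow> real" and \<epsilon> :: real
  assumes "f \<in> Linf unit_interval"
    and "(\<integral>x. f x \<partial>unit_interval) = 0"
    and "\<epsilon> > 0"
  shows "\<exists>g T. g \<in> Linf unit_interval
    \<and> Linf_norm unit_interval g \<le> ereal (1 + \<epsilon>) * Linf_norm unit_interval f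
    \<and> measure_preserving_mod0 unit_interval unit_interval T
    \<and> (AE x in unit_interval. f x = (g \<circ> T) x - g x)"
proof -
  interpret homogeneous_interval unit_interval by (rule unit_interval_homogeneous)
  have f: "f \<in> borel_measurable unit_interval" "Linf_norm unit_interval f < \<infinity>"
    using assms(1) by (auto simp: Linf_def)
  note [measurable] = f(1)
  have le: "AE x in unit_interval. ereal \<bar>f x\<bar> \<le> Linf_norm unit_interval f"
    unfolding Linf_norm_def by (rule esssup_AE)
  have nonneg: "0 \<le> Linf_norm unit_interval f"
  proof -
    have "AE x in unit_interval. 0 \<le> Linf_norm unit_interval f"
      using le by eventually_elim (rule order_trans[rotated], auto)
    then show ?thesis by simp
  qed
  obtain c where c: "Linf_norm unit_interval f = ereal c" "0 \<le> c"
    using f(2) nonneg by (cases "Linf_norm unit_interval f") auto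
  \<comment> \<open>Changing \<open>f\<close> on a null set makes the bound valid everywhere and the function Borel on the whole line.\<close>
  define h where "h x = (if x \<in> {0..1} \<and> \<bar>f x\<bar> \<le> c then f x else 0)" for x
  have h_meas: "h \<in> borel_measurable borel"
  proof -
    have "(\<lambda>x. if \<bar>f x\<bar> \<le> c then f x else 0) \<in> borel_measurable unit_interval" by measurable
    then have "(\<lambda>x. if \<bar>f x\<bar> \<le> c then f x else 0) \<in> borel_measurable (restrict_space borel {0..1})"
      unfolding measurable_cong_sets[OF sets_eq refl] .
    then have "(\<lambda>x. if x \<in> {0..1} then if \<bar>f x\<bar> \<le> c then f x else 0 else 0) \<in> borel_measurable borel"
      by (subst (asm) measurable_restrict_space_iff) auto
    moreover have "(\<lambda>x. if x \<in> {0..1} then if \<bar>f x\<bar> \<le> c then f x else 0 else 0) = h"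
      by (auto simp: h_def fun_eq_iff)
    ultimately show ?thesis by simp
  qed
  have fh: "AE x in unit_interval. f x = h x"
    using le AE_space by eventually_elim (auto simp: h_def c space_eq)
  have hM: "h \<in> borel_measurable unit_interval" by (rule measurable_from_borel[OF h_meas])
  have "(\<integral>x. f x \<partial>unit_interval) = (\<integral>x. h x \<partial>unit_interval)"
    by (rule integral_cong_AE[OF f(1) hM fh])
  then have mean: "(\<integral>x. h x \<partial>unit_interval) = 0" using assms(2) by simp
  have h_bound: "\<bar>h x\<bar> \<le> c" and h_off: "x \<notin> {0..1} \<Longrightarrow> h x = 0" for x
    using c(2) by (auto simp: h_def)
  obtain T T' g where T: "automorphism unit_interval T T'" and g: "g \<in> borel_measurable unit_interval"
    "AE x in unit_interval. h x = g (T x) - g x" "AE x in unit_interval. \<bar>g x\<bar> \<le> c"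
    by (rule bounded_coboundary[OF h_meas h_bound h_off mean])
  note [measurable] = g(1)
  have norm_g: "Linf_norm unit_interval g \<le> ereal c"
    unfolding Linf_norm_def using g(3) by (intro esssup_I) auto
  also have "\<dots> \<le> ereal (1 + \<epsilon>) * ereal c"
    using c(2) assms(3) by (simp add: mult_right_mono[of 1 "1 + \<epsilon>" c, simplified])
  finally have bound: "Linf_norm unit_interval g \<le> ereal (1 + \<epsilon>) * Linf_norm unit_interval f"
    by (simp add: c)
  have "g \<in> Linf unit_interval" using norm_g g(1) by (auto simp: Linf_def intro: le_less_trans)
  moreover have "measure_preserving_mod0 unit_interval unit_interval T"
  proof (rule measure_preserving_mod0_of_automorphism[OF T])
    have T_meas: "T \<in> unit_interval \<rightarrow>\<^sub>M unit_interval" "T' \<in> unit_interval \<rightarrow>\<^sub>M unit_interval"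
      using T unfolding automorphism_def by - (elim conjE, assumption)+
    note m = measurable_compose[OF T_meas(1) measurable_to_borel[OF T_meas(2)]]
      measurable_compose[OF T_meas(2) measurable_to_borel[OF T_meas(1)]]
    have id: "(\<lambda>x. x) \<in> borel_measurable unit_interval" by (rule measurable_from_borel) simp
    show "{x \<in> space unit_interval. T' (T x) = x} \<in> sets unit_interval"
      by (rule borel_measurable_eq[OF m(1) id])
    show "{x \<in> space unit_interval. T (T' x) = x} \<in> sets unit_interval"
      by (rule borel_measurable_eq[OF m(2) id])
  qed
  moreover have "AE x in unit_interval. f x = (g \<circ> T) x - g x"
    using fh g(2) by eventually_elim simp
  ultimately show ?thesis using bound by blast
qed

end
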